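(* The class of exact graphs strictly contains the class of compact graphs. More precisely: 1. If $G$ is a compact graph, then $G$ is also exact. 2. Let $G_1,\dots,G_m$ be $k$-regular connected compact graphs, and let $G=\bigsqcup_{i=1}^mG_i$ be their disjoint union. Then $G$ is always exact, but $G$ may not be compact. Indeed, $G$ is compact if and only if $G_i\cong G_j$ for all $1\le i,j\le m$.
   Context: Graphs are finite, simple and undirected. For a graph $G$ on $\{1,\dots,n\}$ with adjacency matrix $A_G$, let $$P_G=\Big\{P\in\mathbb{R}^{n\times n}: PA_G=A_GP,\ \sum_{i}P_{i,j}=1\ \forall j,\ \sum_{j}P_{i,j}=1\ \forall i,\ P_{i,j}\ge0\ \forall i,j\Big\},$$ and let $IP_G=\mathrm{conv}(P_G\cap\mathbb{Z}^{n\times n})$ be its integer hull. $G$ is compact if $P_G=IP_G$. Let $I_G\subseteq\mathbb{R}[P_{i,j}:1\le i,j\le n]$ be the ideal generated by the entries of $PA_G-A_GP$, the polynomials $\sum_iP_{i,j}-1$ ($1\le j\le n$), $\sum_jP_{i,j}-1$ ($1\le i\le n$), and $P_{i,j}^2-P_{i,j}$ ($1\le i,j\le n$); its real zero set $V_{\mathbb{R}}(I_G)$ is the set of permutation matrices of automorphisms of $G$. For an ideal $I\subseteq\mathbb{R}[x_1,\dots,x_N]$, a polynomial $f$ is $k$-sos mod $I$ if there are polynomials $h_1,\dots,h_r$ of degree at most $k$ with $f-\sum_ih_i^2\in I$. The $k$-th theta body is $TH_k(I)=\{x\in\mathbb{R}^N: f(x)\ge0\text{ for every polynomial } f \text{ of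 degree at most } 1 \text{ that is }k\text{-sos mod }I\}$. $I$ (or $V_{\mathbb{R}}(I)$) is $k$-exact if $\overline{\mathrm{conv}(V_{\mathbb{R}}(I))}=TH_k(I)$. A graph $G$ is exact if $I_G$ is $1$-exact. *)

theory Defs
  imports
    "HOL-Analysis.Analysis"
    "HOL-Analysis.Finite_Function_Topology"
    "HOL-Library.Poly_Mapping"
    "Graph_Theory.Pair_Digraph"
    "Graph_Theory.Digraph_Component"
    "Graph_Theory.Digraph_Isomorphism"
begin

section \<open>Real polynomials and theta bodies\<close>

text \<open>
  A polynomial is a finitely supported map from monomials to coefficients, and a monomial a
  finitely supported map from variables to exponents; the multiplication of
  \<^theory>\<open>HOL-Library.Poly_Mapping\<close> is then polynomial multiplication. The variables of a
  polynomial ring are the elements of an explicit set \<open>X\<close>, so that finite variable sets of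
  any size can share one type.
\<close>

type_synonym 'v mpoly = "('v \<Rightarrow>\<^sub>0 nat) \<Rightarrow>\<^sub>0 real"

text \<open>
  A point of the space with coordinates \<open>X\<close> is a finitely supported function that vanishes
  outside \<open>X\<close>. For finite \<open>X\<close> the norm of \<^theory>\<open>HOL-Analysis.Finite_Function_Topology\<close> (the
  sum of the absolute values) induces the usual topology on this closed subspace, so
  \<^const>\<open>hull\<close> and \<^const>\<open>closure\<close> have their usual meaning.
\<close>

type_synonym 'v point = "'v \<Rightarrow>\<^sub>0 real"

definition coord_space :: "'v set \<Rightarrow> 'v point set" where
  "coord_space X = {x. Poly_Mapping.keys x \<subseteq> X}"

definition poly_ring :: "'v set \<Rightarrow> 'v mpoly set" where
  "poly_ring X = {p. \<forall>m\<in>Poly_Mapping.keys p. Poly_Mapping.keys m \<subseteq> X}"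

definition pvar :: "'v \<Rightarrow> 'v mpoly" where
  "pvar v = Poly_Mapping.single (Poly_Mapping.single v 1) 1"

text \<open>The zero polynomial gets degree \<open>0\<close>; only upper bounds on the degree are used.\<close>

definition total_degree :: "'v mpoly \<Rightarrow> nat" where
  "total_degree p =
     Max (insert 0 ((\<lambda>m. \<Sum>v\<in>Poly_Mapping.keys m. Poly_Mapping.lookup m v) ` Poly_Mapping.keys p))"

definition peval :: "'v mpoly \<Rightarrow> 'v point \<Rightarrow> real" where
  "peval p x = (\<Sum>m\<in>Poly_Mapping.keys p. Poly_Mapping.lookup p m *
     (\<Prod>v\<in>Poly_Mapping.keys m. Poly_Mapping.lookup x v ^ Poly_Mapping.lookup m v))"

definition ideal_generated :: "'v set \<Rightarrow> 'v mpoly set \<Rightarrow> 'v mpoly set" where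
  "ideal_generated X B =
     {(\<Sum>b\<in>S. q b * b) | S q. finite S \<and> S \<subseteq> B \<and> (\<forall>b\<in>S. q b \<in> poly_ring X)}"

definition real_zeros :: "'v set \<Rightarrow> 'v mpoly set \<Rightarrow> 'v point set" where
  "real_zeros X I = {x \<in> coord_space X. \<forall>f\<in>I. peval f x = 0}"

definition sos_mod :: "nat \<Rightarrow> 'v set \<Rightarrow> 'v mpoly set \<Rightarrow> 'v mpoly \<Rightarrow> bool" where
  "sos_mod k X I f \<longleftrightarrow>
     (\<exists>hs. (\<forall>h\<in>set hs. h \<in> poly_ring X \<and> total_degree h \<le> k) \<and> f - (\<Sum>h\<leftarrow>hs. h ^ 2) \<in> I)"

definition theta_body :: "nat \<Rightarrow> 'v set \<Rightarrow> 'v mpoly set \<Rightarrow> 'v point set" where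
  "theta_body k X I =
     {x \<in> coord_space X. \<forall>f\<in>poly_ring X. total_degree f \<le> 1 \<and> sos_mod k X I f \<longrightarrow> peval f x \<ge> 0}"

definition exact_ideal :: "nat \<Rightarrow> 'v set \<Rightarrow> 'v mpoly set \<Rightarrow> bool" where
  "exact_ideal k X I \<longleftrightarrow> closure (convex hull (real_zeros X I)) = theta_body k X I"


section \<open>Compact and exact graphs\<close>

text \<open>
  A finite simple undirected graph is a \<^locale>\<open>pair_graph\<close>: a finite vertex set together with a
  symmetric irreflexive set of ordered pairs. Matrices indexed by the vertices are points whose
  coordinates are the pairs of vertices. The adjacency matrix is polymorphic in its entries since
  it is needed both over the reals and over the polynomials.
\<close>

definition adj :: "'a pair_pre_digraph \<Rightarrow> 'a \<Rightarrow> 'a \<Rightarrow> 'b::zero_neq_one" where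
  "adj G i j = of_bool ((i, j) \<in> parcs G)"

definition matrix_index :: "'a pair_pre_digraph \<Rightarrow> ('a \<times> 'a) set" where
  "matrix_index G = pverts G \<times> pverts G"

definition fractional_automorphisms :: "'a pair_pre_digraph \<Rightarrow> ('a \<times> 'a) point set" where
  "fractional_automorphisms G = {P \<in> coord_space (matrix_index G).
     (\<forall>i\<in>pverts G. \<forall>j\<in>pverts G.
        (\<Sum>l\<in>pverts G. Poly_Mapping.lookup P (i, l) * adj G l j) =
        (\<Sum>l\<in>pverts G. adj G i l * Poly_Mapping.lookup P (l, j))) \<and>
     (\<forall>j\<in>pverts G. (\<Sum>i\<in>pverts G. Poly_Mapping.lookup P (i, j)) = 1) \<and>
     (\<forall>i\<in>pverts G. (\<Sum>j\<in>pverts G. Poly_Mapping.lookup P (i, j)) = 1) \<and>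
     (\<forall>i\<in>pverts G. \<forall>j\<in>pverts G. Poly_Mapping.lookup P (i, j) \<ge> 0)}"

definition integer_hull :: "'v point set \<Rightarrow> 'v point set" where
  "integer_hull S = convex hull (S \<inter> {x. \<forall>v. Poly_Mapping.lookup x v \<in> \<int>})"

definition compact_graph :: "'a pair_pre_digraph \<Rightarrow> bool" where
  "compact_graph G \<longleftrightarrow> fractional_automorphisms G = integer_hull (fractional_automorphisms G)"

definition automorphism_ideal :: "'a pair_pre_digraph \<Rightarrow> ('a \<times> 'a) mpoly set" where
  "automorphism_ideal G = ideal_generated (matrix_index G)
     ({(\<Sum>l\<in>pverts G. pvar (i, l) * adj G l j) - (\<Sum>l\<in>pverts G. adj G i l * pvar (l, j))
         | i j. i \<in> pverts G \<and> j \<in> pverts G}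
      \<union> {(\<Sum>i\<in>pverts G. pvar (i, j)) - 1 | j. j \<in> pverts G}
      \<union> {(\<Sum>j\<in>pverts G. pvar (i, j)) - 1 | i. i \<in> pverts G}
      \<union> {pvar (i, j) ^ 2 - pvar (i, j) | i j. i \<in> pverts G \<and> j \<in> pverts G})"

definition exact_graph :: "'a pair_pre_digraph \<Rightarrow> bool" where
  "exact_graph G \<longleftrightarrow> exact_ideal 1 (matrix_index G) (automorphism_ideal G)"


section \<open>Regular graphs, isomorphism and disjoint unions\<close>

text \<open>Each undirected edge at \<open>v\<close> contributes exactly one outgoing arc.\<close>

definition regular_graph :: "nat \<Rightarrow> 'a pair_pre_digraph \<Rightarrow> bool" where
  "regular_graph k G \<longleftrightarrow> (\<forall>v\<in>pverts G. out_degree (with_proj G) v = k)"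

text \<open>
  The qualified name avoids the topological notion. Connected graphs are nonempty by definition.
\<close>

definition connected_graph :: "'a pair_pre_digraph \<Rightarrow> bool" where
  "connected_graph G \<longleftrightarrow> Digraph_Component.connected (with_proj G)"

definition graph_iso :: "'a pair_pre_digraph \<Rightarrow> 'b pair_pre_digraph \<Rightarrow> bool" where
  "graph_iso G H \<longleftrightarrow> digraph_iso (with_proj G) (with_proj H)"

text \<open>Tagging the vertices with the index makes the union disjoint.\<close>

definition disjoint_union :: "nat \<Rightarrow> (nat \<Rightarrow> 'a pair_pre_digraph) \<Rightarrow> (nat \<times> 'a) pair_pre_digraph" where
  "disjoint_union m Gs =
     \<lparr> pverts = (SIGMA i:{1..m}. pverts (Gs i)),
       parcs = {((i, u), (i, v)) | i u v. i \<in> {1..m} \<and> (u, v) \<in> parcs (Gs i)} \<rparr>"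

definition regular_connected_compact_family :: "nat \<Rightarrow> nat \<Rightarrow> (nat \<Rightarrow> 'a pair_pre_digraph) \<Rightarrow> bool" where
  "regular_connected_compact_family k m Gs \<longleftrightarrow>
     (\<forall>i\<in>{1..m}. pair_graph (Gs i) \<and> regular_graph k (Gs i) \<and> connected_graph (Gs i)
        \<and> compact_graph (Gs i))"

end

(*
  The ideal I_G contains all P_uv^2 - P_uv, so it is real radical and each P_uv is a square modulo
  I_G. Hence the first theta body lies in P_G and vanishes at every entry (u, v) for which no
  automorphism maps u to v. Conversely, a point P of P_G is a convex combination of automorphisms as
  soon as the support of every point of P_G with support inside that of P contains an automorphism:
  subtract as much as possible of that automorphism and induct on the support (Birkhoff).
  If G is compact, every point of P_G has an automorphism in its support, so G is exact.

  Let G be the disjoint union of k-regular connected compact graphs. Each block of P in P_G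
  intertwines two adjacency matrices, so its row and its column sums are constant, being
  eigenvectors of a connected k-regular graph for the eigenvalue k. If nonzero blocks join isomorphic
  components only, then the block sums form a doubly stochastic matrix; Hall's theorem selects a
  permutation of the components with nonzero blocks, and compactness of the components provides an
  isomorphism in the support of each block. This applies to the theta body, whence G is exact, and to
  all of P_G if the components are pairwise isomorphic. Otherwise the matrix with constant entries
  1/n lies in P_G but not in its integer hull, since no automorphism joins non-isomorphic components.
  The triangle and the square show that the last case occurs.
*)
theory Submission
  imports Defs
begin

section \<open>Polynomials, ideals and theta bodies\<close>

lemma sum_lookup_extend:
  assumes "finite K" "Poly_Mapping.keys p \<subseteq> K" and "\<And>m. f m 0 = 0"
  shows "(\<Sum>m\<in>Poly_Mapping.keys p. f m (Poly_Mapping.lookup p m)) =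
    (\<Sum>m\<in>K. f m (Poly_Mapping.lookup p m))"
  using assms by (intro sum.mono_neutral_left) (auto simp: in_keys_iff)

definition mon_eval :: "('v \<Rightarrow>\<^sub>0 nat) \<Rightarrow> 'v point \<Rightarrow> real" where
  "mon_eval m x = (\<Prod>v\<in>Poly_Mapping.keys m. Poly_Mapping.lookup x v ^ Poly_Mapping.lookup m v)"

lemma mon_eval_extend:
  assumes "finite K" "Poly_Mapping.keys m \<subseteq> K"
  shows "mon_eval m x = (\<Prod>v\<in>K. Poly_Mapping.lookup x v ^ Poly_Mapping.lookup m v)"
  unfolding mon_eval_def
  using assms by (intro prod.mono_neutral_left) (auto simp: in_keys_iff)

lemma mon_eval_add: "mon_eval (m + n) x = mon_eval m x * mon_eval n x"
proof -
  \<comment> \<open>A common finite superset of the supports puts all three products over one index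
    set, where exponents add.\<close>
  define K where "K = Poly_Mapping.keys m \<union> Poly_Mapping.keys n"
  have K: "finite K" "Poly_Mapping.keys m \<subseteq> K" "Poly_Mapping.keys n \<subseteq> K"
    "Poly_Mapping.keys (m + n) \<subseteq> K"
    using keys_add[of m n] by (auto simp: K_def)
  show ?thesis
    by (simp add: mon_eval_extend[OF K(1,2)] mon_eval_extend[OF K(1,3)] mon_eval_extend[OF K(1,4)]
        lookup_add power_add prod.distrib)
qed

lemma peval_extend:
  assumes "finite K" "Poly_Mapping.keys p \<subseteq> K"
  shows "peval p x = (\<Sum>m\<in>K. Poly_Mapping.lookup p m * mon_eval m x)"
  unfolding peval_def mon_eval_def[symmetric] using assms by (intro sum_lookup_extend) auto

lemma peval_zero [simp]: "peval 0 x = 0"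
  by (simp add: peval_def)

lemma peval_single: "peval (Poly_Mapping.single m c) x = c * mon_eval m x"
  by (simp add: peval_def mon_eval_def)

lemma peval_add [simp]: "peval (p + q) x = peval p x + peval q x"
proof -
  define K where "K = Poly_Mapping.keys p \<union> Poly_Mapping.keys q"
  have K: "finite K" "Poly_Mapping.keys p \<subseteq> K" "Poly_Mapping.keys q \<subseteq> K"
    "Poly_Mapping.keys (p + q) \<subseteq> K"
    using keys_add[of p q] by (auto simp: K_def)
  show ?thesis
    by (simp add: peval_extend[OF K(1,2)] peval_extend[OF K(1,3)] peval_extend[OF K(1,4)]
        lookup_add distrib_right sum.distrib)
qed

lemma peval_sum [simp]: "peval (\<Sum>a\<in>A. f a) x = (\<Sum>a\<in>A. peval (f a) x)"
  by (induction A rule: infinite_finite_induct) auto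

lemma peval_uminus [simp]: "peval (- p) x = - peval p x"
  using peval_add[of p "- p" x] by simp

lemma peval_diff [simp]: "peval (p - q) x = peval p x - peval q x"
  using peval_add[of p "- q" x] by simp

text \<open>Applied to a polynomial this is the expansion into terms; applied to an exponent map it
  reassembles a monomial from the powers of its variables, as in
  \<open>monomial_expansion\<close>.\<close>

lemma sum_single_keys:
  "(\<Sum>m\<in>Poly_Mapping.keys p. Poly_Mapping.single m (Poly_Mapping.lookup p m)) = p"
  by (rule poly_mapping_eqI)
    (auto simp: lookup_sum lookup_single when_def in_keys_iff)

lemma peval_mult [simp]: "peval (p * q) x = peval p x * peval q x"
proof -
  have "peval (p * q) x =
    peval ((\<Sum>m\<in>Poly_Mapping.keys p. Poly_Mapping.single m (Poly_Mapping.lookup p m)) *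
      (\<Sum>n\<in>Poly_Mapping.keys q. Poly_Mapping.single n (Poly_Mapping.lookup q n))) x"
    by (simp only: sum_single_keys)
  also have "\<dots> = (\<Sum>m\<in>Poly_Mapping.keys p. \<Sum>n\<in>Poly_Mapping.keys q.
      (Poly_Mapping.lookup p m * mon_eval m x) * (Poly_Mapping.lookup q n * mon_eval n x))"
    by (simp add: sum_product mult_single peval_single mon_eval_add mult_ac)
  also have "\<dots> = peval p x * peval q x"
    by (simp add: sum_product[symmetric] peval_def mon_eval_def)
  finally show ?thesis .
qed

definition pconst :: "real \<Rightarrow> 'v mpoly" where
  "pconst c = Poly_Mapping.single 0 c"

lemma pconst_0 [simp]: "pconst 0 = 0"
  and pconst_1 [simp]: "pconst 1 = 1"
  by (simp_all add: pconst_def)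

lemma pconst_add: "pconst (a + b) = pconst a + pconst b"
  and pconst_mult: "pconst (a * b) = pconst a * pconst b"
  by (simp_all add: pconst_def single_add mult_single)

lemma peval_pconst [simp]: "peval (pconst c) x = c"
  by (simp add: pconst_def peval_single mon_eval_def)

lemma peval_1 [simp]: "peval 1 x = 1"
  using peval_pconst[of 1 x] by simp

lemma peval_pvar [simp]: "peval (pvar v) x = Poly_Mapping.lookup x v"
  by (simp add: pvar_def peval_single mon_eval_def)

lemma peval_power [simp]: "peval (p ^ n) x = peval p x ^ n"
  by (induction n) auto

lemma peval_sum_list: "peval (\<Sum>h\<leftarrow>hs. f h) x = (\<Sum>h\<leftarrow>hs. peval (f h) x)"
  by (induction hs) auto

lemma peval_adj [simp]: "peval (adj G i j) x = adj G i j"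
  by (simp add: adj_def of_bool_def)

section \<open>Polynomials in the variables \<open>X\<close>: closure and induction\<close>

lemma poly_ring_add [intro]: "p \<in> poly_ring X \<Longrightarrow> q \<in> poly_ring X \<Longrightarrow> p + q \<in> poly_ring X"
  using keys_add[of p q] by (auto simp: poly_ring_def)

lemma poly_ring_uminus [intro]: "p \<in> poly_ring X \<Longrightarrow> - p \<in> poly_ring X"
  by (auto simp: poly_ring_def in_keys_iff)

lemma poly_ring_diff [intro]: "p \<in> poly_ring X \<Longrightarrow> q \<in> poly_ring X \<Longrightarrow> p - q \<in> poly_ring X"
  using poly_ring_add[of p X "- q"] by auto

lemma poly_ring_mult [intro]:
  assumes "p \<in> poly_ring X" "q \<in> poly_ring X"
  shows "p * q \<in> poly_ring X"
  unfolding poly_ring_def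
proof safe
  fix m v assume "m \<in> Poly_Mapping.keys (p * q)" and v: "v \<in> Poly_Mapping.keys m"
  then obtain a b where "m = a + b" "a \<in> Poly_Mapping.keys p" "b \<in> Poly_Mapping.keys q"
    using keys_mult[of p q] by auto
  then show "v \<in> X"
    using assms v keys_add[of a b] unfolding poly_ring_def by blast
qed

lemma poly_ring_pconst [intro, simp]: "pconst c \<in> poly_ring X"
  by (auto simp: poly_ring_def pconst_def)

lemma poly_ring_0 [intro, simp]: "0 \<in> poly_ring X"
  and poly_ring_1 [intro, simp]: "1 \<in> poly_ring X"
  using poly_ring_pconst[of 0 X] poly_ring_pconst[of 1 X] by simp_all

lemma poly_ring_pvar [simp]: "pvar v \<in> poly_ring X \<longleftrightarrow> v \<in> X"
  by (auto simp: poly_ring_def pvar_def)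

lemma poly_ring_sum [intro]: "(\<And>a. a \<in> A \<Longrightarrow> f a \<in> poly_ring X) \<Longrightarrow> sum f A \<in> poly_ring X"
  by (induction A rule: infinite_finite_induct) auto

lemma poly_ring_prod [intro]: "(\<And>a. a \<in> A \<Longrightarrow> f a \<in> poly_ring X) \<Longrightarrow> prod f A \<in> poly_ring X"
  by (induction A rule: infinite_finite_induct) auto

lemma poly_ring_power [intro]: "p \<in> poly_ring X \<Longrightarrow> p ^ n \<in> poly_ring X"
  by (induction n) auto

lemma poly_ring_adj [simp]: "adj G i j \<in> poly_ring X"
  by (simp add: adj_def of_bool_def)

lemma monomial_expansion:
  "Poly_Mapping.single m c = pconst c * (\<Prod>v\<in>Poly_Mapping.keys m. pvar v ^ Poly_Mapping.lookup m v)"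
proof -
  have pow: "pvar v ^ n = Poly_Mapping.single (Poly_Mapping.single v n) 1" for v :: 'a and n
    by (induction n) (auto simp: pvar_def mult_single single_add[symmetric])
  have "(\<Prod>v\<in>K. Poly_Mapping.single (g v) (1::real)) = Poly_Mapping.single (\<Sum>v\<in>K. g v) 1"
    if "finite K" for K :: "'a set" and g :: "'a \<Rightarrow> 'a \<Rightarrow>\<^sub>0 nat"
    using that by induction (auto simp: mult_single)
  then show ?thesis
    by (simp add: pow pconst_def mult_single sum_single_keys)
qed

text \<open>By \<open>monomial_expansion\<close> a polynomial over \<open>X\<close> is built from
  constants and variables by sums and products, so a property stable under both extends to
  it.\<close>

lemma poly_ring_induct [consumes 1, case_names const var add mult]:
  assumes "p \<in> poly_ring X"
    and const: "\<And>c. P (pconst c)"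
    and var: "\<And>v. v \<in> X \<Longrightarrow> P (pvar v)"
    and add: "\<And>p q. P p \<Longrightarrow> P q \<Longrightarrow> P (p + q)"
    and mult: "\<And>p q. P p \<Longrightarrow> P q \<Longrightarrow> P (p * q)"
  shows "P p"
proof -
  have one: "P 1" and zero: "P 0"
    using const[of 1] const[of 0] by auto
  have pow: "P (pvar v ^ n)" if "v \<in> X" for v n
    by (induction n) (auto intro: one mult var that)
  have prod: "P (\<Prod>v\<in>K. pvar v ^ g v)" if "finite K" "K \<subseteq> X" for K and g :: "_ \<Rightarrow> nat"
    using that by induction (auto intro: one mult pow)
  have sum: "P (\<Sum>m\<in>K. f m)" if "\<And>m. m \<in> K \<Longrightarrow> P (f m)" for K and f :: "('a \<Rightarrow>\<^sub>0 nat) \<Rightarrow> 'a mpoly"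
    using that by (induction K rule: infinite_finite_induct) (auto intro: zero add)
  have "P (\<Sum>m\<in>Poly_Mapping.keys p. Poly_Mapping.single m (Poly_Mapping.lookup p m))"
    using assms(1) by (intro sum) (auto simp: monomial_expansion poly_ring_def intro!: mult const prod)
  then show ?thesis
    by (simp add: sum_single_keys)
qed

section \<open>Generated ideals and the Boolean Nullstellensatz\<close>

lemma ideal_generated_superset: "b \<in> B \<Longrightarrow> b \<in> ideal_generated X B"
  unfolding ideal_generated_def by (auto intro!: exI[of _ "{b}"] exI[of _ "\<lambda>_. 1"])

lemma ideal_generated_0 [simp]: "0 \<in> ideal_generated X B"
  unfolding ideal_generated_def by (auto intro!: exI[of _ "{}"])

lemma ideal_generated_mult:
  assumes "p \<in> poly_ring X" "f \<in> ideal_generated X B"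
  shows "p * f \<in> ideal_generated X B"
proof -
  obtain S q where "finite S" "S \<subseteq> B" "\<forall>b\<in>S. q b \<in> poly_ring X" "f = (\<Sum>b\<in>S. q b * b)"
    using assms(2) unfolding ideal_generated_def by blast
  then show ?thesis
    using assms(1) unfolding ideal_generated_def
    by (auto intro!: exI[of _ S] exI[of _ "\<lambda>b. p * q b"] simp: sum_distrib_left mult.assoc)
qed

lemma ideal_generated_add:
  assumes "f \<in> ideal_generated X B" "g \<in> ideal_generated X B"
  shows "f + g \<in> ideal_generated X B"
proof -
  obtain S q where f: "finite S" "S \<subseteq> B" "\<forall>b\<in>S. q b \<in> poly_ring X" "f = (\<Sum>b\<in>S. q b * b)"
    using assms(1) unfolding ideal_generated_def by blast
  obtain T r where g: "finite T" "T \<subseteq> B" "\<forall>b\<in>T. r b \<in> poly_ring X" "g = (\<Sum>b\<in>T. r b * b)"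
    using assms(2) unfolding ideal_generated_def by blast
  \<comment> \<open>The two sets of generators may differ; coefficients extended by zero let both
    sums run over the union.\<close>
  define q' r' where "q' b = (if b \<in> S then q b else 0)" and "r' b = (if b \<in> T then r b else 0)" for b
  have "f = (\<Sum>b\<in>S \<union> T. q' b * b)" "g = (\<Sum>b\<in>S \<union> T. r' b * b)"
    unfolding f g using f(1) g(1) by (auto intro!: sum.mono_neutral_cong_left simp: q'_def r'_def)
  then have "f + g = (\<Sum>b\<in>S \<union> T. (q' b + r' b) * b)"
    by (simp add: distrib_right sum.distrib)
  moreover have "\<forall>b\<in>S \<union> T. q' b + r' b \<in> poly_ring X"
    using f g by (auto simp: q'_def r'_def)
  ultimately show ?thesis
    unfolding ideal_generated_def using f g
    by (auto intro!: exI[of _ "S \<union> T"] exI[of _ "\<lambda>b. q' b + r' b"])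
qed

lemma ideal_generated_uminus: "f \<in> ideal_generated X B \<Longrightarrow> - f \<in> ideal_generated X B"
  using ideal_generated_mult[OF poly_ring_uminus[OF poly_ring_1], of f X B] by simp

lemma ideal_generated_diff:
  "f \<in> ideal_generated X B \<Longrightarrow> g \<in> ideal_generated X B \<Longrightarrow> f - g \<in> ideal_generated X B"
  using ideal_generated_add[of f X B "- g"] ideal_generated_uminus[of g X B] by simp

lemma ideal_generated_sum:
  "(\<And>a. a \<in> A \<Longrightarrow> f a \<in> ideal_generated X B) \<Longrightarrow> sum f A \<in> ideal_generated X B"
  by (induction A rule: infinite_finite_induct) (auto intro: ideal_generated_add)

text \<open>Evaluation is a ring homomorphism, so vanishing on the generators passes to their
  combinations.\<close>

lemma real_zeros_ideal_generated:
  "real_zeros X (ideal_generated X B) = {x \<in> coord_space X. \<forall>b\<in>B. peval b x = 0}"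
  by (auto simp: real_zeros_def ideal_generated_superset)
    (auto simp: ideal_generated_def subset_iff)

text \<open>
  The indicator polynomials of the points of the cube form a partition of unity, and modulo the
  ideal every polynomial acts on such an indicator as its value at the point. Hence only the
  points of the zero set contribute, and the ideal is real radical.
\<close>

lemma boolean_nullstellensatz:
  fixes X :: "'v set"
  assumes X: "finite X"
    and bool: "\<And>v. v \<in> X \<Longrightarrow> pvar v ^ 2 - pvar v \<in> ideal_generated X B"
    and B: "B \<subseteq> poly_ring X"
    and f: "f \<in> poly_ring X"
    and vanish: "\<And>x. x \<in> real_zeros X (ideal_generated X B) \<Longrightarrow> peval f x = 0"
  shows "f \<in> ideal_generated X B"
proof -
  define I where "I = ideal_generated X B"
  note I_intros = ideal_generated_add[of _ X B, folded I_def] ideal_generated_mult[of _ X _ B, folded I_def]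
  \<comment> \<open>\<open>d A\<close> is the indicator polynomial of the cube point with support
    \<open>A\<close>, which is \<open>pt A\<close>.\<close>
  define d :: "'v set \<Rightarrow> 'v mpoly" where
    "d A = (\<Prod>v\<in>A. pvar v) * (\<Prod>v\<in>X - A. 1 - pvar v)" for A
  define pt :: "'v set \<Rightarrow> 'v point" where "pt A = (\<Sum>v\<in>A. Poly_Mapping.single v 1)" for A
  have lookup_pt: "Poly_Mapping.lookup (pt A) v = of_bool (v \<in> A)" if "A \<subseteq> X" for A v
    using finite_subset[OF that X]
    by (auto simp: pt_def lookup_sum lookup_single when_def)
  have d_ring: "d A \<in> poly_ring X" if "A \<subseteq> X" for A
    using that by (auto simp: d_def intro!: poly_ring_mult poly_ring_prod poly_ring_diff)
  \<comment> \<open>\<open>d A\<close> has the factor \<open>pvar v\<close> or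
    \<open>1 - pvar v\<close>; splitting it off exposes \<open>pvar v ^ 2 - pvar v\<close> as a
    factor of the difference.\<close>
  have var_d: "pvar v * d A - pconst (of_bool (v \<in> A)) * d A \<in> I" if "A \<subseteq> X" "v \<in> X" for v A
  proof (cases "v \<in> A")
    case True
    have *: "d A = pvar v * ((\<Prod>v\<in>A - {v}. pvar v) * (\<Prod>v\<in>X - A. 1 - pvar v))"
      unfolding d_def using True finite_subset[OF that(1) X] by (simp add: prod.remove mult.assoc)
    have "pvar v * d A - pconst (of_bool (v \<in> A)) * d A =
      ((\<Prod>v\<in>A - {v}. pvar v) * (\<Prod>v\<in>X - A. 1 - pvar v)) * (pvar v ^ 2 - pvar v)"
      unfolding * using True by (simp add: algebra_simps power2_eq_square)
    also have "\<dots> \<in> I"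
      using that bool[of v] by (intro I_intros) (auto simp: I_def intro!: poly_ring_mult poly_ring_prod poly_ring_diff)
    finally show ?thesis .
  next
    case False
    have *: "d A = (1 - pvar v) * ((\<Prod>v\<in>A. pvar v) * (\<Prod>v\<in>X - A - {v}. 1 - pvar v))"
      unfolding d_def using False X that prod.remove[of "X - A" v "\<lambda>v. 1 - pvar v"]
      by (simp add: mult_ac)
    have "pvar v * d A - pconst (of_bool (v \<in> A)) * d A =
      (- ((\<Prod>v\<in>A. pvar v) * (\<Prod>v\<in>X - A - {v}. 1 - pvar v))) * (pvar v ^ 2 - pvar v)"
      unfolding * using False by (simp add: algebra_simps power2_eq_square)
    also have "\<dots> \<in> I"
      using that bool[of v] by (intro I_intros) (auto simp: I_def intro!: poly_ring_mult poly_ring_prod poly_ring_diff poly_ring_uminus)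
    finally show ?thesis .
  qed
  have poly_d: "p * d A - pconst (peval p (pt A)) * d A \<in> I" if "A \<subseteq> X" "p \<in> poly_ring X" for p A
  proof -
    have "p \<in> poly_ring X \<and> p * d A - pconst (peval p (pt A)) * d A \<in> I"
      using that(2)
    proof (induction p rule: poly_ring_induct)
      case (const c)
      then show ?case by (simp add: I_def)
    next
      case (var v)
      then show ?case using var_d[OF that(1) var] by (simp add: lookup_pt that)
    next
      case (add p q)
      have "(p + q) * d A - pconst (peval (p + q) (pt A)) * d A =
        (p * d A - pconst (peval p (pt A)) * d A) + (q * d A - pconst (peval q (pt A)) * d A)"
        by (simp add: pconst_add algebra_simps)
      also have "\<dots> \<in> I" using add by (intro I_intros) auto
      finally show ?case using add by auto
    next
      case (mult p q)
      have "(p * q) * d A - pconst (peval (p * q) (pt A)) * d A =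
        p * (q * d A - pconst (peval q (pt A)) * d A) +
        pconst (peval q (pt A)) * (p * d A - pconst (peval p (pt A)) * d A)"
        by (simp add: pconst_mult algebra_simps)
      also have "\<dots> \<in> I" using mult by (intro I_intros) auto
      finally show ?case using mult by auto
    qed
    then show ?thesis ..
  qed
  have fd: "f * d A \<in> I" if A: "A \<subseteq> X" for A
  proof (cases "pt A \<in> real_zeros X I")
    case True
    then show ?thesis using poly_d[OF A f] vanish[of "pt A"] by (simp add: I_def)
  next
    case False
    have "pt A \<in> coord_space X"
      using A lookup_pt[OF A] by (auto simp: coord_space_def in_keys_iff split: if_splits)
    \<comment> \<open>Off the zero set some generator \<open>g\<close> is nonzero at
      \<open>pt A\<close>. Modulo the ideal it acts on \<open>d A\<close> as this constant, and
      dividing by the constant puts \<open>d A\<close> itself into the ideal.\<close>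
    then obtain g where g: "g \<in> B" "peval g (pt A) \<noteq> 0"
      using False by (auto simp: I_def real_zeros_ideal_generated)
    have "d A * g \<in> I"
      using g d_ring[OF A] by (intro I_intros) (auto simp: I_def ideal_generated_superset)
    moreover have "g * d A - pconst (peval g (pt A)) * d A \<in> I"
      using poly_d[OF A] g B by auto
    ultimately have "d A * g - (g * d A - pconst (peval g (pt A)) * d A) \<in> I"
      unfolding I_def by (rule ideal_generated_diff)
    then have "pconst (peval g (pt A)) * d A \<in> I"
      by (simp add: mult.commute)
    then have "pconst (inverse (peval g (pt A))) * (pconst (peval g (pt A)) * d A) \<in> I"
      by (rule I_intros(2)[OF poly_ring_pconst])
    then have "d A \<in> I"
      using g(2) by (simp add: mult.assoc[symmetric] pconst_mult[symmetric])
    then show ?thesis using f by (intro I_intros)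
  qed
  \<comment> \<open>Each factor on the right is \<open>1\<close>; expanding the product over subsets
    gives the partition of unity.\<close>
  have "(\<Sum>A\<in>Pow X. d A) = (\<Prod>v\<in>X. pvar v + (1 - pvar v))"
    unfolding d_def using prod_add[OF X, of pvar "\<lambda>v. 1 - pvar v"] by simp
  then have "f = (\<Sum>A\<in>Pow X. f * d A)"
    by (simp add: sum_distrib_left[symmetric])
  also have "\<dots> \<in> ideal_generated X B"
    using fd unfolding I_def by (intro ideal_generated_sum) auto
  finally show ?thesis .
qed

section \<open>Affine polynomials and theta bodies\<close>

lemma lookup_scaleR [simp]:
  "Poly_Mapping.lookup (c *\<^sub>R x) v = c *\<^sub>R Poly_Mapping.lookup x v"
proof -
  have "finite {v. c *\<^sub>R Poly_Mapping.lookup x v \<noteq> 0}"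
    by (rule finite_subset[OF _ finite_lookup[of x]]) auto
  then show ?thesis by (simp add: scaleR_poly_mapping_def)
qed

lemma coord_space_iff: "x \<in> coord_space X \<longleftrightarrow> (\<forall>v. v \<notin> X \<longrightarrow> Poly_Mapping.lookup x v = 0)"
  by (auto simp: coord_space_def in_keys_iff)

lemma total_degree_le_iff:
  "total_degree p \<le> k \<longleftrightarrow> (\<forall>m\<in>Poly_Mapping.keys p.
     (\<Sum>v\<in>Poly_Mapping.keys m. Poly_Mapping.lookup m v) \<le> k)"
  unfolding total_degree_def by simp

lemma total_degree_add:
  "total_degree p \<le> k \<Longrightarrow> total_degree q \<le> k \<Longrightarrow> total_degree (p + q) \<le> k"
  using keys_add[of p q] by (auto simp: total_degree_le_iff)

lemma total_degree_uminus [simp]: "total_degree (- p) = total_degree p"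
  by (simp add: total_degree_def)

lemma total_degree_diff:
  "total_degree p \<le> k \<Longrightarrow> total_degree q \<le> k \<Longrightarrow> total_degree (p - q) \<le> k"
  using total_degree_add[of p k "- q"] by simp

lemma total_degree_0 [simp]: "total_degree 0 = 0"
  by (simp add: total_degree_def)

lemma total_degree_sum:
  "(\<And>a. a \<in> A \<Longrightarrow> total_degree (f a) \<le> k) \<Longrightarrow> total_degree (sum f A) \<le> k"
  by (induction A rule: infinite_finite_induct) (auto intro: total_degree_add)

lemma total_degree_1 [simp]: "total_degree 1 \<le> k"
  by (simp add: total_degree_le_iff)

lemma total_degree_pvar [simp]: "total_degree (pvar v) \<le> 1"
  by (simp add: total_degree_le_iff pvar_def)

lemma total_degree_adj_mult [simp]:
  "total_degree (pvar v * adj G i j) \<le> 1" "total_degree (adj G i j * pvar v) \<le> 1"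
  using total_degree_pvar[of v] by (auto simp: adj_def of_bool_def simp del: total_degree_pvar)

text \<open>A monomial of degree at most \<open>1\<close> is the constant \<open>1\<close> or a
  single variable. Both respect affine combinations, the constant because
  \<open>a + b = 1\<close>.\<close>

lemma mon_eval_affine:
  assumes "(\<Sum>v\<in>Poly_Mapping.keys m. Poly_Mapping.lookup m v) \<le> 1" "a + b = 1"
  shows "mon_eval m (a *\<^sub>R x + b *\<^sub>R y) = a * mon_eval m x + b * mon_eval m y"
proof (cases "Poly_Mapping.keys m = {}")
  case True
  then show ?thesis using assms(2) by (simp add: mon_eval_def)
next
  case False
  then obtain v where v: "v \<in> Poly_Mapping.keys m" by blast
  \<comment> \<open>Each occurring variable has exponent at least \<open>1\<close>, so there are at
    most as many variables as the degree.\<close>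
  have "card (Poly_Mapping.keys m) \<le> (\<Sum>v\<in>Poly_Mapping.keys m. Poly_Mapping.lookup m v)"
    using sum_mono[of "Poly_Mapping.keys m" "\<lambda>_. 1" "Poly_Mapping.lookup m"]
    by (simp add: in_keys_iff Suc_le_eq)
  then have "card (Poly_Mapping.keys m) \<le> card {v}" using assms(1) by simp
  then have keys: "Poly_Mapping.keys m = {v}"
    using v by (metis card_seteq empty_subsetI finite_keys insert_subset)
  then have "Poly_Mapping.lookup m v = 1"
    using assms(1) v by (auto simp: in_keys_iff)
  then show ?thesis by (simp add: mon_eval_def keys lookup_add)
qed

lemma peval_affine:
  assumes "total_degree f \<le> 1" "a + b = 1"
  shows "peval f (a *\<^sub>R x + b *\<^sub>R y) = a * peval f x + b * peval f y"
proof -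
  have *: "peval f z = (\<Sum>m\<in>Poly_Mapping.keys f. Poly_Mapping.lookup f m * mon_eval m z)" for z
    by (simp add: peval_def mon_eval_def)
  have "peval f (a *\<^sub>R x + b *\<^sub>R y) =
    (\<Sum>m\<in>Poly_Mapping.keys f. Poly_Mapping.lookup f m * (a * mon_eval m x + b * mon_eval m y))"
    unfolding * using assms by (intro sum.cong refl) (simp add: mon_eval_affine total_degree_le_iff)
  also have "\<dots> = a * peval f x + b * peval f y"
    by (simp add: * sum_distrib_left sum.distrib[symmetric] algebra_simps)
  finally show ?thesis .
qed

text \<open>The defining polynomials have degree at most \<open>1\<close>, so the theta body is
  given by affine inequalities.\<close>

lemma convex_theta_body: "convex (theta_body k X I)"
proof (rule convexI)
  fix x y and a b :: real
  assume "x \<in> theta_body k X I" "y \<in> theta_body k X I" "a \<ge> 0" "b \<ge> 0" "a + b = 1"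
  then show "a *\<^sub>R x + b *\<^sub>R y \<in> theta_body k X I"
    by (simp add: theta_body_def peval_affine coord_space_iff lookup_add)
qed

text \<open>At a zero of the ideal, \<open>f\<close> takes the value of its sum of squares.\<close>

lemma real_zeros_subset_theta_body: "real_zeros X I \<subseteq> theta_body k X I"
proof
  fix x assume x: "x \<in> real_zeros X I"
  have "peval f x \<ge> 0" if "sos_mod k X I f" for f
  proof -
    obtain hs where "f - (\<Sum>h\<leftarrow>hs. h ^ 2) \<in> I"
      using \<open>sos_mod k X I f\<close> by (auto simp: sos_mod_def)
    then have "peval (f - (\<Sum>h\<leftarrow>hs. h ^ 2)) x = 0" using x unfolding real_zeros_def by blast
    then have "peval f x = (\<Sum>h\<leftarrow>hs. peval (h ^ 2) x)"
      using peval_sum_list[of "\<lambda>h. h ^ 2" hs x] by simp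
    also have "\<dots> \<ge> 0" by (intro sum_list_nonneg) auto
    finally show ?thesis .
  qed
  then show "x \<in> theta_body k X I" using x by (simp add: theta_body_def real_zeros_def)
qed

text \<open>Both \<open>f\<close> and \<open>- f\<close> are congruent to the empty sum of squares,
  so both are nonnegative on the theta body. Generators of degree at most \<open>1\<close> thus
  survive as equations.\<close>

lemma theta_body_ideal_eq_0:
  assumes x: "x \<in> theta_body k X (ideal_generated X B)" and f: "f \<in> ideal_generated X B"
    "f \<in> poly_ring X" "total_degree f \<le> 1"
  shows "peval f x = 0"
proof -
  have "sos_mod k X (ideal_generated X B) f" "sos_mod k X (ideal_generated X B) (- f)"
    using f ideal_generated_uminus[OF f(1)] by (auto simp: sos_mod_def intro!: exI[of _ "[]"])
  then have "peval f x \<ge> 0" "peval (- f) x \<ge> 0"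
    using x f poly_ring_uminus[OF f(2)] by (auto simp: theta_body_def simp del: peval_uminus)
  then show ?thesis by simp
qed

section \<open>Doubly stochastic matrices\<close>

text \<open>
  Rado's argument: in a minimal family satisfying Hall's condition no set has two elements, since
  the two index sets witnessing that neither can be removed contradict submodularity.
\<close>

lemma hall_marriage:
  fixes F :: "'i \<Rightarrow> 'b set"
  assumes I: "finite I" and "\<And>i. i \<in> I \<Longrightarrow> finite (F i)"
    and "\<And>J. J \<subseteq> I \<Longrightarrow> card J \<le> card (\<Union> (F ` J))"
  shows "\<exists>g. inj_on g I \<and> (\<forall>i\<in>I. g i \<in> F i)"
  using assms(2,3)
proof (induction "\<Sum>i\<in>I. card (F i)" arbitrary: F rule: less_induct)
  case less
  note fin = less.prems(1) and hall = less.prems(2)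
  have ne: "F i \<noteq> {}" if "i \<in> I" for i
    using hall[of "{i}"] that by auto
  show ?case
  proof (cases "\<exists>i\<in>I. \<exists>x\<in>F i. \<exists>y\<in>F i. x \<noteq> y")
    case False
    define g where "g i = (SOME x. x \<in> F i)" for i
    have g: "F i = {g i}" if "i \<in> I" for i
      using ne[OF that] False that some_in_eq[of "F i"] unfolding g_def by blast
    have "inj_on g I"
    proof (rule inj_onI, rule ccontr)
      fix i j assume "i \<in> I" "j \<in> I" "g i = g j" "i \<noteq> j"
      then show False using hall[of "{i, j}"] g by auto
    qed
    then show ?thesis using g by (intro exI[of _ g]) auto
  next
    case True
    then obtain i x y where i: "i \<in> I" "x \<in> F i" "y \<in> F i" "x \<noteq> y" by blast
    define R where "R z = F(i := F i - {z})" for z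
    show ?thesis
    proof (cases "\<exists>z\<in>F i. \<forall>J. J \<subseteq> I \<longrightarrow> card J \<le> card (\<Union> (R z ` J))")
      case True
      then obtain z where z: "z \<in> F i" "\<And>J. J \<subseteq> I \<Longrightarrow> card J \<le> card (\<Union> (R z ` J))" by blast
      have sub: "R z j \<subseteq> F j" for j by (auto simp: R_def)
      have "(\<Sum>j\<in>I. card (R z j)) < (\<Sum>j\<in>I. card (F j))"
      proof (rule sum_strict_mono_ex1)
        show "\<forall>j\<in>I. card (R z j) \<le> card (F j)"
          using fin sub by (auto intro: card_mono)
        show "\<exists>j\<in>I. card (R z j) < card (F j)"
          using i z fin by (intro bexI[of _ i] psubset_card_mono) (auto simp: R_def)
      qed (rule I)
      then have "\<exists>g. inj_on g I \<and> (\<forall>j\<in>I. g j \<in> R z j)"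
        using z fin sub by (intro less.hyps) (auto intro: finite_subset[OF sub])
      then show ?thesis using sub by blast
    next
      case False
      \<comment> \<open>If removing \<open>z\<close> destroys Hall's condition, a violating set
        contains \<open>i\<close>, since the other sets keep their neighbourhoods. Dropping
        \<open>i\<close> from it turns the strict inequality into \<open>\<le>\<close>.\<close>
      have "\<exists>J. J \<subseteq> I - {i} \<and> card (\<Union> (F ` J) \<union> (F i - {z})) \<le> card J" if z: "z \<in> F i" for z
      proof -
        obtain J where J: "J \<subseteq> I" "\<not> card J \<le> card (\<Union> (R z ` J))"
          using False z by blast
        have "i \<in> J"
        proof (rule ccontr)
          assume "i \<notin> J"
          then have "R z ` J = F ` J" by (auto simp: R_def)
          then show False using J hall by simp
        qed
        have "\<Union> (R z ` J) = \<Union> (F ` (J - {i})) \<union> (F i - {z})"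
          using \<open>i \<in> J\<close> by (auto simp: R_def split: if_splits)
        moreover have "card J = Suc (card (J - {i}))"
          using \<open>i \<in> J\<close> J I by (metis card_Suc_Diff1 finite_subset)
        ultimately show ?thesis using J by (intro exI[of _ "J - {i}"]) auto
      qed
      then obtain J K where J: "J \<subseteq> I - {i}" "card (\<Union> (F ` J) \<union> (F i - {x})) \<le> card J"
        and K: "K \<subseteq> I - {i}" "card (\<Union> (F ` K) \<union> (F i - {y})) \<le> card K"
        using i by meson
      have fJK: "finite J" "finite K" using J K I by (auto intro: finite_subset)
      define S T where "S = \<Union> (F ` J) \<union> (F i - {x})" and "T = \<Union> (F ` K) \<union> (F i - {y})"
      have fST: "finite S" "finite T" using J K fin i fJK by (auto simp: S_def T_def)
      have "card (insert i (J \<union> K)) \<le> card (\<Union> (F ` insert i (J \<union> K)))"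
        using J K i by (intro hall) auto
      \<comment> \<open>\<open>F i\<close> lies in \<open>S \<union> T\<close> because
        \<open>x \<noteq> y\<close>: the element missing from one difference is in the
        other.\<close>
      also have "\<dots> \<le> card (S \<union> T)"
        using fST i by (intro card_mono) (auto simp: S_def T_def)
      finally have 1: "Suc (card (J \<union> K)) \<le> card (S \<union> T)"
        using J K fJK by (subst (asm) card_insert_disjoint) auto
      have "card (J \<inter> K) \<le> card (\<Union> (F ` (J \<inter> K)))"
        using J K by (intro hall) auto
      also have "\<dots> \<le> card (S \<inter> T)"
        using fST by (intro card_mono) (auto simp: S_def T_def)
      finally have 2: "card (J \<inter> K) \<le> card (S \<inter> T)" .
      \<comment> \<open>\<open>card S + card T\<close> is at most \<open>card J + card K\<close> by
        the choice of \<open>J\<close> and \<open>K\<close>, but strictly larger by adding 1 and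
        2.\<close>
      show ?thesis
        using 1 2 J(2) K(2) card_Un_Int[OF fJK] card_Un_Int[OF fST]
        unfolding S_def[symmetric] T_def[symmetric] by linarith
    qed
  qed
qed

text \<open>Hall's condition holds for the positive entries: the rows in a set of indices carry mass
  equal to its size, all of it in the columns that meet their supports, and each column holds mass
  at most \<open>1\<close>.\<close>

lemma doubly_stochastic_permutation:
  fixes r :: "'i \<Rightarrow> 'i \<Rightarrow> real"
  assumes I: "finite I" and nonneg: "\<And>i j. i \<in> I \<Longrightarrow> j \<in> I \<Longrightarrow> r i j \<ge> 0"
    and row: "\<And>i. i \<in> I \<Longrightarrow> (\<Sum>j\<in>I. r i j) = 1"
    and col: "\<And>j. j \<in> I \<Longrightarrow> (\<Sum>i\<in>I. r i j) = 1"
  shows "\<exists>\<sigma>. bij_betw \<sigma> I I \<and> (\<forall>i\<in>I. r i (\<sigma> i) > 0)"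
proof -
  define F where "F i = {j\<in>I. r i j > 0}" for i
  have "\<exists>g. inj_on g I \<and> (\<forall>i\<in>I. g i \<in> F i)"
  proof (rule hall_marriage)
    fix J assume J: "J \<subseteq> I"
    define N where "N = \<Union> (F ` J)"
    have N: "N \<subseteq> I" by (auto simp: N_def F_def)
    have "real (card J) = (\<Sum>i\<in>J. \<Sum>j\<in>I. r i j)"
      using J row by (simp add: subset_iff)
    also have "\<dots> = (\<Sum>i\<in>J. \<Sum>j\<in>N. r i j)"
    proof (rule sum.cong[OF refl])
      fix i assume i: "i \<in> J"
      have "r i j = 0" if "j \<in> I - N" for j
        using nonneg[of i j] i that J by (force simp: N_def F_def)
      then show "(\<Sum>j\<in>I. r i j) = (\<Sum>j\<in>N. r i j)"
        using I N by (intro sum.mono_neutral_right) auto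
    qed
    also have "\<dots> = (\<Sum>j\<in>N. \<Sum>i\<in>J. r i j)"
      by (rule sum.swap)
    also have "\<dots> \<le> (\<Sum>j\<in>N. \<Sum>i\<in>I. r i j)"
      using J N I nonneg by (intro sum_mono sum_mono2) auto
    also have "\<dots> = card N"
      using N col by (simp add: subset_iff)
    finally show "card J \<le> card (\<Union> (F ` J))" by (simp add: N_def)
  qed (use I in \<open>auto simp: F_def\<close>)
  then obtain g where g: "inj_on g I" "\<forall>i\<in>I. g i \<in> F i" by blast
  then have "g ` I \<subseteq> I" by (auto simp: F_def)
  then have "bij_betw g I I"
    using g I by (simp add: bij_betw_def endo_inj_surj)
  then show ?thesis using g by (auto simp: F_def)
qed

section \<open>Fractional isomorphisms\<close>

text \<open>Two graphs are allowed so that the notion applies to blocks between different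
  components. Entries outside the vertex sets are unconstrained.\<close>

definition fractional_iso :: "'a pair_pre_digraph \<Rightarrow> 'b pair_pre_digraph \<Rightarrow> ('a \<Rightarrow> 'b \<Rightarrow> real) \<Rightarrow> bool" where
  "fractional_iso G H P \<longleftrightarrow>
     (\<forall>i\<in>pverts G. \<forall>j\<in>pverts H.
        (\<Sum>l\<in>pverts H. P i l * adj H l j) = (\<Sum>l\<in>pverts G. adj G i l * P l j)) \<and>
     (\<forall>j\<in>pverts H. (\<Sum>i\<in>pverts G. P i j) = 1) \<and>
     (\<forall>i\<in>pverts G. (\<Sum>j\<in>pverts H. P i j) = 1) \<and>
     (\<forall>i\<in>pverts G. \<forall>j\<in>pverts H. P i j \<ge> 0)"

definition iso_map :: "'a pair_pre_digraph \<Rightarrow> 'b pair_pre_digraph \<Rightarrow> ('a \<Rightarrow> 'b) \<Rightarrow> bool" where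
  "iso_map G H \<pi> \<longleftrightarrow> bij_betw \<pi> (pverts G) (pverts H) \<and>
     (\<forall>u\<in>pverts G. \<forall>v\<in>pverts G. (u, v) \<in> parcs G \<longleftrightarrow> (\<pi> u, \<pi> v) \<in> parcs H)"

lemma iso_map_inv:
  assumes "iso_map G H \<pi>"
  shows "iso_map H G (the_inv_into (pverts G) \<pi>)"
proof -
  have b: "bij_betw \<pi> (pverts G) (pverts H)" using assms by (auto simp: iso_map_def)
  have inv: "\<pi> (the_inv_into (pverts G) \<pi> u) = u" "the_inv_into (pverts G) \<pi> u \<in> pverts G"
    if "u \<in> pverts H" for u
    using b that by (simp_all add: f_the_inv_into_f_bij_betw the_inv_into_into bij_betw_def)
  then show ?thesis
    using assms bij_betw_the_inv_into[OF b] by (auto simp: iso_map_def)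
qed

lemma iso_map_comp:
  "iso_map G H \<pi> \<Longrightarrow> iso_map H K \<rho> \<Longrightarrow> iso_map G K (\<rho> \<circ> \<pi>)"
  unfolding iso_map_def by (auto intro: bij_betw_trans simp: bij_betwE)

lemma iso_map_adj:
  "iso_map G H \<pi> \<Longrightarrow> u \<in> pverts G \<Longrightarrow> v \<in> pverts G \<Longrightarrow> adj H (\<pi> u) (\<pi> v) = adj G u v"
  by (auto simp: iso_map_def adj_def)

text \<open>Tail and head are \<open>fst\<close> and \<open>snd\<close> in both graphs, so the arc
  map of an isomorphism is determined by its vertex map.\<close>

lemma graph_iso_iff:
  assumes "pair_graph G" "pair_graph H"
  shows "graph_iso G H \<longleftrightarrow> (\<exists>\<pi>. iso_map G H \<pi>)"
proof
  interpret G: pair_graph G by fact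
  interpret H: pair_graph H by fact
  assume "graph_iso G H"
  then obtain f where f: "pre_digraph.digraph_isomorphism (with_proj G) f"
    and H: "with_proj H = app_iso f (with_proj G)"
    by (auto simp: graph_iso_def digraph_iso_def)
  have V: "pverts H = iso_verts f ` pverts G"
    using arg_cong[OF H, of verts] by simp
  have A: "parcs H = iso_arcs f ` parcs G"
    using arg_cong[OF H, of arcs] by simp
  have t: "iso_tail f = fst" using arg_cong[OF H, of tail] by simp
  have h: "iso_head f = snd" using arg_cong[OF H, of head] by simp
  have inj: "inj_on (iso_verts f) (pverts G)"
    and arc: "\<And>a. a \<in> parcs G \<Longrightarrow> iso_arcs f a = (iso_verts f (fst a), iso_verts f (snd a))"
    using f by (auto simp: pre_digraph.digraph_isomorphism_def t h prod_eq_iff)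
  have "(u, v) \<in> parcs G \<longleftrightarrow> (iso_verts f u, iso_verts f v) \<in> parcs H"
    if "u \<in> pverts G" "v \<in> pverts G" for u v
  proof
    show "(u, v) \<in> parcs G \<Longrightarrow> (iso_verts f u, iso_verts f v) \<in> parcs H"
      using arc[of "(u, v)"] by (auto simp: A intro!: rev_image_eqI)
    assume "(iso_verts f u, iso_verts f v) \<in> parcs H"
    then obtain a b where ab: "(a, b) \<in> parcs G" "(iso_verts f u, iso_verts f v) = iso_arcs f (a, b)"
      by (auto simp: A)
    then have "u = a" "v = b"
      using arc[OF ab(1)] that G.in_arcsD1[OF ab(1)] G.in_arcsD2[OF ab(1)] inj
      by (auto dest: inj_onD)
    then show "(u, v) \<in> parcs G" using ab by simp
  qed
  then show "\<exists>\<pi>. iso_map G H \<pi>"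
    using inj by (intro exI[of _ "iso_verts f"]) (auto simp: iso_map_def V bij_betw_def)
next
  interpret G: pair_graph G by fact
  interpret H: pair_graph H by fact
  assume "\<exists>\<pi>. iso_map G H \<pi>"
  then obtain \<pi> where \<pi>: "iso_map G H \<pi>" by blast
  define f where "f = \<lparr> iso_verts = \<pi>, iso_arcs = map_prod \<pi> \<pi>, iso_head = snd, iso_tail = fst \<rparr>"
  have inj: "inj_on \<pi> (pverts G)" and img: "\<pi> ` pverts G = pverts H"
    using \<pi> by (auto simp: iso_map_def bij_betw_def)
  have sub: "parcs G \<subseteq> pverts G \<times> pverts G"
    by (auto dest: G.in_arcsD1 G.in_arcsD2)
  have "inj_on (map_prod \<pi> \<pi>) (parcs G)"
    using map_prod_inj_on[OF inj inj] sub by (rule inj_on_subset)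
  then have "pre_digraph.digraph_isomorphism (with_proj G) f"
    using inj G.pair_wf_digraph
    by (auto simp: pre_digraph.digraph_isomorphism_def f_def wf_digraph_wp_iff)
  moreover have "map_prod \<pi> \<pi> ` parcs G = parcs H"
  proof
    show "map_prod \<pi> \<pi> ` parcs G \<subseteq> parcs H"
      using \<pi> by (auto simp: iso_map_def dest: G.in_arcsD1 G.in_arcsD2)
    show "parcs H \<subseteq> map_prod \<pi> \<pi> ` parcs G"
    proof
      fix e assume e: "e \<in> parcs H"
      then have "fst e \<in> \<pi> ` pverts G" "snd e \<in> \<pi> ` pverts G"
        unfolding img by (simp_all add: H.arc_fst_in_verts H.arc_snd_in_verts)
      then obtain u v where "u \<in> pverts G" "v \<in> pverts G" "fst e = \<pi> u" "snd e = \<pi> v" by blast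
      moreover from this have "e = (\<pi> u, \<pi> v)" by (simp add: prod_eq_iff)
      ultimately show "e \<in> map_prod \<pi> \<pi> ` parcs G"
        using e \<pi> by (intro rev_image_eqI[of "(u, v)"]) (auto simp: iso_map_def)
    qed
  qed
  then have "with_proj H = app_iso f (with_proj G)"
    by (simp add: with_proj_def app_iso_def f_def img)
  ultimately show "graph_iso G H"
    by (auto simp: graph_iso_def digraph_iso_def)
qed

definition positive_iso :: "'a pair_pre_digraph \<Rightarrow> 'b pair_pre_digraph \<Rightarrow> ('a \<Rightarrow> 'b \<Rightarrow> real) \<Rightarrow> bool" where
  "positive_iso G H P \<longleftrightarrow> (\<exists>\<pi>. iso_map G H \<pi> \<and> (\<forall>u\<in>pverts G. P u (\<pi> u) > 0))"

text \<open>Relabelling the columns of \<open>P\<close> along \<open>\<phi>\<close> gives a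
  fractional automorphism of \<open>G\<close>; an automorphism in its support, followed by
  \<open>\<phi>\<close>, lies in the support of \<open>P\<close>.\<close>

lemma positive_iso_transport:
  assumes \<phi>: "iso_map G H \<phi>" and P: "fractional_iso G H P"
    and G: "\<And>Q. fractional_iso G G Q \<Longrightarrow> positive_iso G G Q"
  shows "positive_iso G H P"
proof -
  have bij: "bij_betw \<phi> (pverts G) (pverts H)" using \<phi> by (auto simp: iso_map_def)
  note bij' = bij_betwE[OF bij, rule_format]
  have re: "(\<Sum>l\<in>pverts G. f (\<phi> l)) = (\<Sum>l\<in>pverts H. f l)" for f :: "_ \<Rightarrow> real"
    using sum.reindex_bij_betw[OF bij] .
  have "fractional_iso G G (\<lambda>u v. P u (\<phi> v))"
    unfolding fractional_iso_def
  proof (intro conjI ballI)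
    fix i j assume ij: "i \<in> pverts G" "j \<in> pverts G"
    have "(\<Sum>l\<in>pverts G. P i (\<phi> l) * adj G l j) = (\<Sum>l\<in>pverts G. P i (\<phi> l) * adj H (\<phi> l) (\<phi> j))"
      using ij by (intro sum.cong refl) (simp add: iso_map_adj[OF \<phi>])
    also have "\<dots> = (\<Sum>l\<in>pverts H. P i l * adj H l (\<phi> j))"
      by (rule re)
    also have "\<dots> = (\<Sum>l\<in>pverts G. adj G i l * P l (\<phi> j))"
      using P ij bij' by (auto simp: fractional_iso_def)
    finally show "(\<Sum>l\<in>pverts G. P i (\<phi> l) * adj G l j) = (\<Sum>l\<in>pverts G. adj G i l * P l (\<phi> j))" .
  qed (use P bij' re in \<open>auto simp: fractional_iso_def\<close>)
  from G[OF this] obtain \<pi> where "iso_map G G \<pi>" "\<forall>u\<in>pverts G. P u (\<phi> (\<pi> u)) > 0"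
    by (auto simp: positive_iso_def)
  then show ?thesis
    using iso_map_comp[OF _ \<phi>] by (auto simp: positive_iso_def intro!: exI[of _ "\<phi> \<circ> \<pi>"])
qed

lemma fractional_automorphisms_iff:
  "P \<in> fractional_automorphisms G \<longleftrightarrow>
     P \<in> coord_space (matrix_index G) \<and> fractional_iso G G (\<lambda>i j. Poly_Mapping.lookup P (i, j))"
  by (simp add: fractional_automorphisms_def fractional_iso_def)

lemma fractional_iso_cong:
  assumes "\<And>i j. i \<in> pverts G \<Longrightarrow> j \<in> pverts H \<Longrightarrow> P i j = Q i j"
  shows "fractional_iso G H P \<longleftrightarrow> fractional_iso G H Q"
  unfolding fractional_iso_def using assms by (simp cong: sum.cong)

text \<open>The coefficients may be negative, so nonnegativity is asked of the result. Birkhoff's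
  argument subtracts a permutation matrix and relies on this generality.\<close>

lemma fractional_iso_affine:
  assumes P: "fractional_iso G H P" and Q: "fractional_iso G H Q" and ab: "a + b = 1"
    and nonneg: "\<And>i j. i \<in> pverts G \<Longrightarrow> j \<in> pverts H \<Longrightarrow> a * P i j + b * Q i j \<ge> 0"
  shows "fractional_iso G H (\<lambda>i j. a * P i j + b * Q i j)"
  unfolding fractional_iso_def
proof (intro conjI ballI)
  fix i j assume ij: "i \<in> pverts G" "j \<in> pverts H"
  have "(\<Sum>l\<in>pverts H. (a * P i l + b * Q i l) * adj H l j) =
    a * (\<Sum>l\<in>pverts H. P i l * adj H l j) + b * (\<Sum>l\<in>pverts H. Q i l * adj H l j)"
    by (simp add: distrib_right sum.distrib sum_distrib_left mult.assoc)
  also have "\<dots> = a * (\<Sum>l\<in>pverts G. adj G i l * P l j) + b * (\<Sum>l\<in>pverts G. adj G i l * Q l j)"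
    using P Q ij by (simp add: fractional_iso_def)
  also have "\<dots> = (\<Sum>l\<in>pverts G. adj G i l * (a * P l j + b * Q l j))"
    by (simp add: distrib_left sum.distrib sum_distrib_left mult_ac)
  finally show "(\<Sum>l\<in>pverts H. (a * P i l + b * Q i l) * adj H l j) =
    (\<Sum>l\<in>pverts G. adj G i l * (a * P l j + b * Q l j))" .
next
  show "(\<Sum>i\<in>pverts G. a * P i j + b * Q i j) = 1" if "j \<in> pverts H" for j
    using P Q ab that by (simp add: fractional_iso_def sum.distrib sum_distrib_left[symmetric])
  show "(\<Sum>j\<in>pverts H. a * P i j + b * Q i j) = 1" if "i \<in> pverts G" for i
    using P Q ab that by (simp add: fractional_iso_def sum.distrib sum_distrib_left[symmetric])
qed (use nonneg in auto)

lemma convex_fractional_automorphisms: "convex (fractional_automorphisms G)"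
proof (rule convexI)
  fix P Q and a b :: real
  assume PQ: "P \<in> fractional_automorphisms G" "Q \<in> fractional_automorphisms G"
    and ab: "a \<ge> 0" "b \<ge> 0" "a + b = 1"
  have "fractional_iso G G (\<lambda>i j. a * Poly_Mapping.lookup P (i, j) + b * Poly_Mapping.lookup Q (i, j))"
    using PQ ab by (intro fractional_iso_affine) (auto simp: fractional_automorphisms_iff fractional_iso_def)
  moreover have "a *\<^sub>R P + b *\<^sub>R Q \<in> coord_space (matrix_index G)"
    using PQ by (simp add: fractional_automorphisms_iff coord_space_iff lookup_add)
  ultimately show "a *\<^sub>R P + b *\<^sub>R Q \<in> fractional_automorphisms G"
    by (simp add: fractional_automorphisms_iff lookup_add)
qed

section \<open>Automorphisms as integral points\<close>

definition perm_point :: "'a pair_pre_digraph \<Rightarrow> ('a \<Rightarrow> 'a) \<Rightarrow> ('a \<times> 'a) point" where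
  "perm_point G \<pi> = (\<Sum>u\<in>pverts G. Poly_Mapping.single (u, \<pi> u) 1)"

definition automorphism_points :: "'a pair_pre_digraph \<Rightarrow> ('a \<times> 'a) point set" where
  "automorphism_points G = perm_point G ` {\<pi>. iso_map G G \<pi>}"

context pair_graph
begin

lemma finite_matrix_index: "finite (matrix_index G)"
  by (simp add: matrix_index_def pair_finite_verts)

lemma lookup_perm_point:
  "Poly_Mapping.lookup (perm_point G \<pi>) (u, v) = of_bool (u \<in> pverts G \<and> v = \<pi> u)"
proof -
  have "Poly_Mapping.lookup (perm_point G \<pi>) (u, v) =
    (\<Sum>w\<in>pverts G. if w = u then of_bool (v = \<pi> u) else 0)"
    unfolding perm_point_def lookup_sum
    by (intro sum.cong) (auto simp: lookup_single when_def)
  then show ?thesis by (simp add: pair_finite_verts)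
qed

text \<open>The maps are arbitrary outside the vertices and may be infinitely many; their points are
  0-1 matrices, encoded by subsets of the finite index set.\<close>

lemma finite_automorphism_points: "finite (automorphism_points G)"
proof (rule finite_subset)
  show "automorphism_points G \<subseteq> (\<lambda>A. \<Sum>p\<in>A. Poly_Mapping.single p 1) ` Pow (matrix_index G)"
  proof
    fix P assume "P \<in> automorphism_points G"
    then obtain \<pi> where \<pi>: "iso_map G G \<pi>" "P = perm_point G \<pi>"
      by (auto simp: automorphism_points_def)
    have "P = (\<Sum>p\<in>(\<lambda>u. (u, \<pi> u)) ` pverts G. Poly_Mapping.single p 1)"
      unfolding \<pi> perm_point_def by (subst sum.reindex) (auto simp: inj_on_def)
    moreover have "(\<lambda>u. (u, \<pi> u)) ` pverts G \<subseteq> matrix_index G"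
      using \<pi>(1) by (auto simp: iso_map_def matrix_index_def bij_betwE)
    ultimately show "P \<in> (\<lambda>A. \<Sum>p\<in>A. Poly_Mapping.single p 1) ` Pow (matrix_index G)" by blast
  qed
qed (simp add: finite_matrix_index)

lemma fractional_iso_perm:
  assumes \<pi>: "iso_map G G \<pi>"
  shows "fractional_iso G G (\<lambda>u v. of_bool (u \<in> pverts G \<and> v = \<pi> u))"
proof -
  have bij: "bij_betw \<pi> (pverts G) (pverts G)" using \<pi> by (auto simp: iso_map_def)
  note fin = pair_finite_verts
  show ?thesis
    unfolding fractional_iso_def
  proof (intro conjI ballI)
    fix i j assume ij: "i \<in> pverts G" "j \<in> pverts G"
    obtain w where w: "w \<in> pverts G" "j = \<pi> w"
      using ij bij by (auto simp: bij_betw_def)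
    have "(\<Sum>l\<in>pverts G. of_bool (i \<in> pverts G \<and> l = \<pi> i) * adj G l j) =
      (\<Sum>l\<in>pverts G. if l = \<pi> i then adj G l j else (0::real))"
      using ij by (intro sum.cong) auto
    also have "\<dots> = adj G (\<pi> i) j"
      using fin ij bij by (simp add: bij_betwE)
    also have "\<dots> = adj G i w"
      using ij w \<pi> by (simp add: iso_map_adj)
    also have "\<dots> = (\<Sum>l\<in>pverts G. if l = w then adj G i l else 0)"
      using fin w by simp
    also have "\<dots> = (\<Sum>l\<in>pverts G. adj G i l * of_bool (l \<in> pverts G \<and> j = \<pi> l))"
      using w bij by (intro sum.cong) (auto simp: bij_betw_def dest: inj_onD)
    finally show "(\<Sum>l\<in>pverts G. of_bool (i \<in> pverts G \<and> l = \<pi> i) * adj G l j) =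
      (\<Sum>l\<in>pverts G. adj G i l * (of_bool (l \<in> pverts G \<and> j = \<pi> l) :: real))" .
  next
    fix j assume j: "j \<in> pverts G"
    have "(\<Sum>i\<in>pverts G. of_bool (i \<in> pverts G \<and> j = \<pi> i)) =
      (\<Sum>i\<in>pverts G. (if \<pi> i = j then 1 else (0::real)))"
      by (intro sum.cong) auto
    also have "\<dots> = (\<Sum>l\<in>pverts G. (if l = j then 1 else 0))"
      by (rule sum.reindex_bij_betw[OF bij])
    finally show "(\<Sum>i\<in>pverts G. of_bool (i \<in> pverts G \<and> j = \<pi> i)) = (1::real)"
      using fin j by simp
  next
    fix i assume i: "i \<in> pverts G"
    have "(\<Sum>j\<in>pverts G. of_bool (i \<in> pverts G \<and> j = \<pi> i)) =
      (\<Sum>j\<in>pverts G. (if j = \<pi> i then 1 else (0::real)))"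
      using i by (intro sum.cong) auto
    then show "(\<Sum>j\<in>pverts G. of_bool (i \<in> pverts G \<and> j = \<pi> i)) = (1::real)"
      using fin i bij by (simp add: bij_betwE)
  qed auto
qed

lemma perm_point_fractional:
  assumes "iso_map G G \<pi>"
  shows "perm_point G \<pi> \<in> fractional_automorphisms G"
  using assms fractional_iso_perm[OF assms]
  by (auto simp: fractional_automorphisms_iff lookup_perm_point coord_space_iff
      matrix_index_def iso_map_def bij_betwE)

text \<open>Integral entries of a doubly stochastic matrix are 0 or 1. The rows then define a map,
  the columns make it injective, and commutation makes it an automorphism.\<close>

lemma integral_fractional_automorphism:
  assumes P: "P \<in> fractional_automorphisms G" and int: "\<And>v. Poly_Mapping.lookup P v \<in> \<int>"
  shows "P \<in> automorphism_points G"
proof -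
  define Q where "Q u v = Poly_Mapping.lookup P (u, v)" for u v
  have frac: "fractional_iso G G Q" and coord: "P \<in> coord_space (matrix_index G)"
    using P by (simp_all add: fractional_automorphisms_iff Q_def[abs_def])
  note fin = pair_finite_verts
  have nonneg: "Q u v \<ge> 0" if "u \<in> pverts G" "v \<in> pverts G" for u v
    using frac that by (simp add: fractional_iso_def)
  have row: "(\<Sum>v\<in>pverts G. Q u v) = 1" and col: "(\<Sum>v\<in>pverts G. Q v u) = 1" if "u \<in> pverts G" for u
    using frac that by (simp_all add: fractional_iso_def)
  have "Q u v \<le> 1" if "u \<in> pverts G" "v \<in> pverts G" for u v
    using member_le_sum[of v "pverts G" "Q u"] nonneg row that fin by auto
  then have bool: "Q u v = 0 \<or> Q u v = 1" if "u \<in> pverts G" "v \<in> pverts G" for u v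
  proof -
    obtain z where "Q u v = of_int z" using int Q_def by (metis Ints_cases)
    then show ?thesis using nonneg[OF that] \<open>\<And>u v. _ \<Longrightarrow> _ \<Longrightarrow> Q u v \<le> 1\<close>[OF that] by auto
  qed
  have pair: "f v + f w \<le> 1"
    if "v \<in> pverts G" "w \<in> pverts G" "v \<noteq> w" "\<And>x. x \<in> pverts G \<Longrightarrow> f x \<ge> 0" "(\<Sum>x\<in>pverts G. f x) = 1"
    for f :: "'a \<Rightarrow> real" and v w
    using sum_mono2[of "pverts G" "{v, w}" f] that fin by auto
  have "\<exists>v\<in>pverts G. Q u v = 1" if "u \<in> pverts G" for u
  proof (rule ccontr)
    assume "\<not> ?thesis"
    then have "(\<Sum>v\<in>pverts G. Q u v) = 0" using bool that by (intro sum.neutral) blast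
    then show False using row that by simp
  qed
  then obtain \<pi> where \<pi>: "\<And>u. u \<in> pverts G \<Longrightarrow> \<pi> u \<in> pverts G \<and> Q u (\<pi> u) = 1" by metis
  have Q: "Q u v = of_bool (v = \<pi> u)" if "u \<in> pverts G" "v \<in> pverts G" for u v
  proof (cases "v = \<pi> u")
    case False
    then show ?thesis
      using pair[of v "\<pi> u" "Q u"] \<pi>[of u] that nonneg[of u] row[of u] bool[of u v] by auto
  qed (use \<pi> that in auto)
  have inj: "inj_on \<pi> (pverts G)"
  proof (rule inj_onI, rule ccontr)
    fix u w assume "u \<in> pverts G" "w \<in> pverts G" "\<pi> u = \<pi> w" "u \<noteq> w"
    then show False
      using pair[of u w "\<lambda>x. Q x (\<pi> u)"] \<pi>[of u] \<pi>[of w] nonneg[of _ "\<pi> u"] col[of "\<pi> u"] by auto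
  qed
  then have bij: "bij_betw \<pi> (pverts G) (pverts G)"
    using \<pi> fin by (auto simp: bij_betw_def endo_inj_surj image_subset_iff)
  have "(adj G u w :: real) = adj G (\<pi> u) (\<pi> w)" if "u \<in> pverts G" "w \<in> pverts G" for u w
  proof -
    \<comment> \<open>The commutation relation is read at the entry \<open>(u, \<pi> w)\<close>,
      where one summation index survives on either side.\<close>
    have "adj G (\<pi> u) (\<pi> w) = (\<Sum>l\<in>pverts G. if l = \<pi> u then adj G l (\<pi> w) else (0::real))"
      using that \<pi> fin by simp
    also have "\<dots> = (\<Sum>l\<in>pverts G. Q u l * adj G l (\<pi> w))"
      using that by (intro sum.cong) (auto simp: Q)
    also have "\<dots> = (\<Sum>l\<in>pverts G. adj G u l * Q l (\<pi> w))"
      using frac that \<pi> by (simp add: fractional_iso_def)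
    also have "\<dots> = (\<Sum>l\<in>pverts G. if l = w then adj G u l else 0)"
      using that \<pi> inj by (intro sum.cong) (auto simp: Q dest: inj_onD)
    also have "\<dots> = adj G u w" using that fin by simp
    finally show ?thesis by simp
  qed
  then have "(u, w) \<in> parcs G \<longleftrightarrow> (\<pi> u, \<pi> w) \<in> parcs G" if "u \<in> pverts G" "w \<in> pverts G" for u w
    using that by (metis adj_def of_bool_eq_iff)
  then have "iso_map G G \<pi>"
    using bij by (simp add: iso_map_def)
  moreover have "P = perm_point G \<pi>"
  proof (rule poly_mapping_eqI)
    fix p :: "'a \<times> 'a"
    obtain u v where p: "p = (u, v)" by fastforce
    show "Poly_Mapping.lookup P p = Poly_Mapping.lookup (perm_point G \<pi>) p"
    proof (cases "p \<in> matrix_index G")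
      case True
      then show ?thesis using Q[of u v] by (simp add: p lookup_perm_point Q_def matrix_index_def)
    next
      case False
      then have "Poly_Mapping.lookup P p = 0" using coord by (metis coord_space_iff)
      then show ?thesis using False \<pi>[of u] by (auto simp: p lookup_perm_point matrix_index_def)
    qed
  qed
  ultimately show ?thesis by (auto simp: automorphism_points_def)
qed

lemma integral_fractional_automorphisms:
  "fractional_automorphisms G \<inter> {x. \<forall>v. Poly_Mapping.lookup x v \<in> \<int>} = automorphism_points G"
  using integral_fractional_automorphism perm_point_fractional
  by (auto simp: automorphism_points_def lookup_perm_point)

lemma convex_hull_automorphism_points_subset:
  "convex hull (automorphism_points G) \<subseteq> fractional_automorphisms G"
  using convex_fractional_automorphisms perm_point_fractional
  by (intro hull_minimal) (auto simp: automorphism_points_def)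

text \<open>\<open>S\<close> will be \<open>UNIV\<close> for compactness and
  \<open>orbit_pairs\<close> for exactness, so that one Birkhoff argument serves both.\<close>

definition supported_on :: "('a \<times> 'a) set \<Rightarrow> ('a \<Rightarrow> 'a \<Rightarrow> real) \<Rightarrow> bool" where
  "supported_on S Q \<longleftrightarrow> (\<forall>u\<in>pverts G. \<forall>v\<in>pverts G. Q u v \<noteq> 0 \<longrightarrow> (u, v) \<in> S)"

text \<open>Between vertices, these are the pairs in a common orbit of the automorphism
  group.\<close>

definition orbit_pairs :: "('a \<times> 'a) set" where
  "orbit_pairs = {(u, \<pi> u) | u \<pi>. iso_map G G \<pi>}"

text \<open>
  Birkhoff's argument: subtracting from \<open>P\<close> the largest possible multiple of an automorphism in its
  support and rescaling yields a fractional automorphism with smaller support.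
\<close>

lemma fractional_automorphism_in_convex_hull:
  assumes pos: "\<And>Q. fractional_iso G G Q \<Longrightarrow> supported_on S Q \<Longrightarrow> positive_iso G G Q"
    and "P \<in> fractional_automorphisms G" and "supported_on S (\<lambda>u v. Poly_Mapping.lookup P (u, v))"
  shows "P \<in> convex hull (automorphism_points G)"
  using assms(2,3)
proof (induction "card (Poly_Mapping.keys P)" arbitrary: P rule: less_induct)
  case less
  define Q where "Q u v = Poly_Mapping.lookup P (u, v)" for u v
  have frac: "fractional_iso G G Q" and coord: "P \<in> coord_space (matrix_index G)"
    using less.prems(1) by (simp_all add: fractional_automorphisms_iff Q_def[abs_def])
  have orb: "supported_on S Q" using less.prems(2) by (simp add: Q_def[abs_def])
  note fin = pair_finite_verts
  obtain \<pi> where \<pi>: "iso_map G G \<pi>" "\<And>u. u \<in> pverts G \<Longrightarrow> Q u (\<pi> u) > 0"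
    using pos[OF frac orb] by (auto simp: positive_iso_def)
  define M where "M = perm_point G \<pi>"
  have M: "M \<in> automorphism_points G" "M \<in> fractional_automorphisms G"
    using \<pi> perm_point_fractional by (auto simp: M_def automorphism_points_def)
  have in_V: "\<pi> u \<in> pverts G" if "u \<in> pverts G" for u
    using \<pi>(1) that by (auto simp: iso_map_def bij_betwE)
  have le1: "Q u v \<le> 1" if "u \<in> pverts G" "v \<in> pverts G" for u v
    using member_le_sum[of v "pverts G" "Q u"] frac that fin by (auto simp: fractional_iso_def)
  show ?case
  proof (cases "\<forall>u\<in>pverts G. Q u (\<pi> u) = 1")
    \<comment> \<open>Here \<open>P\<close> is itself a permutation matrix. Separating this case
      ensures \<open>e < 1\<close> below, so that dividing by \<open>1 - e\<close> makes
      sense.\<close>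
    case True
    have "Poly_Mapping.lookup P v \<in> \<int>" for v
    proof (cases "v \<in> matrix_index G")
      case v: True
      obtain a b where ab: "v = (a, b)" "a \<in> pverts G" "b \<in> pverts G"
        using v by (auto simp: matrix_index_def)
      have "Q a b = 0" if "b \<noteq> \<pi> a"
      proof -
        have "(\<Sum>x\<in>{b, \<pi> a}. Q a x) \<le> (\<Sum>x\<in>pverts G. Q a x)"
          using frac ab in_V[of a] fin by (intro sum_mono2) (auto simp: fractional_iso_def)
        then have "Q a b + Q a (\<pi> a) \<le> 1"
          using frac ab that by (simp add: fractional_iso_def)
        moreover have "Q a b \<ge> 0" using frac ab by (simp add: fractional_iso_def)
        ultimately show ?thesis using True ab by auto
      qed
      then show ?thesis using True ab by (cases "b = \<pi> a") (auto simp: Q_def)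
    next
      case False
      then show ?thesis using coord by (metis coord_space_iff Ints_0)
    qed
    then show ?thesis
      using integral_fractional_automorphism[OF less.prems(1)] by (simp add: hull_inc)
  next
    case False
    then have ne: "pverts G \<noteq> {}" by auto
    \<comment> \<open>This is the largest multiple of \<open>M\<close> that can be subtracted
      without making an entry negative.\<close>
    define e where "e = Min ((\<lambda>u. Q u (\<pi> u)) ` pverts G)"
    have "e \<in> (\<lambda>u. Q u (\<pi> u)) ` pverts G"
      unfolding e_def using fin ne by (intro Min_in) auto
    then obtain u0 where u0: "u0 \<in> pverts G" "e = Q u0 (\<pi> u0)" by auto
    have e_le: "e \<le> Q u (\<pi> u)" if "u \<in> pverts G" for u
      unfolding e_def using fin that by (intro Min_le) auto
    have e0: "e > 0" using u0 \<pi> by simp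
    obtain u1 where "u1 \<in> pverts G" "Q u1 (\<pi> u1) \<noteq> 1" using False by auto
    then have e1: "e < 1" using e_le[of u1] le1[of u1 "\<pi> u1"] in_V[of u1] by auto
    \<comment> \<open>The coefficients sum to \<open>1\<close>, so the linear equations persist. The
      entry at \<open>(u0, \<pi> u0)\<close> becomes \<open>0\<close>, which shrinks the
      support.\<close>
    define R where "R = (1 / (1 - e)) *\<^sub>R P + (- e / (1 - e)) *\<^sub>R M"
    have R: "Poly_Mapping.lookup R (u, v) = (1 / (1 - e)) * Q u v +
        (- e / (1 - e)) * Poly_Mapping.lookup M (u, v)" for u v
      by (simp add: R_def Q_def lookup_minus)
    have R': "Poly_Mapping.lookup R (u, v) = (Q u v - e * of_bool (u \<in> pverts G \<and> v = \<pi> u)) / (1 - e)" for u v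
      unfolding R M_def lookup_perm_point by (simp add: diff_divide_distrib)
    have nonneg: "Poly_Mapping.lookup R (u, v) \<ge> 0" if "u \<in> pverts G" "v \<in> pverts G" for u v
      unfolding R' using e_le[of u] e1 that frac by (auto simp: fractional_iso_def)
    have keys: "Poly_Mapping.keys R \<subseteq> Poly_Mapping.keys P"
    proof
      fix p assume p: "p \<in> Poly_Mapping.keys R"
      obtain u v where uv: "p = (u, v)" by fastforce
      then have "Q u v \<noteq> 0"
        using p \<pi>(2)[of u] e1 by (auto simp: in_keys_iff R' split: if_splits)
      then show "p \<in> Poly_Mapping.keys P" by (simp add: uv in_keys_iff Q_def)
    qed
    have "(u0, \<pi> u0) \<in> Poly_Mapping.keys P" "(u0, \<pi> u0) \<notin> Poly_Mapping.keys R"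
      using u0 e0 by (simp_all add: in_keys_iff R' flip: Q_def)
    then have "card (Poly_Mapping.keys R) < card (Poly_Mapping.keys P)"
      using keys by (intro psubset_card_mono) auto
    moreover have "R \<in> fractional_automorphisms G"
    proof -
      have "fractional_iso G G (\<lambda>u v. (1 / (1 - e)) * Q u v +
        (- e / (1 - e)) * Poly_Mapping.lookup M (u, v))"
        using nonneg e1 M(2) frac unfolding R
        by (intro fractional_iso_affine) (auto simp: fractional_automorphisms_iff field_simps)
      moreover have "R \<in> coord_space (matrix_index G)"
        using keys coord by (auto simp: coord_space_def)
      ultimately show ?thesis by (simp add: fractional_automorphisms_iff R)
    qed
    moreover have "supported_on S (\<lambda>u v. Poly_Mapping.lookup R (u, v))"
      using orb keys by (auto simp: supported_on_def in_keys_iff Q_def subset_iff)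
    ultimately have "R \<in> convex hull (automorphism_points G)"
      by (rule less.hyps)
    moreover have "M \<in> convex hull (automorphism_points G)"
      using M(1) by (rule hull_inc)
    ultimately have "(1 - e) *\<^sub>R R + e *\<^sub>R M \<in> convex hull (automorphism_points G)"
      using e0 e1 by (intro convexD) auto
    also have "(1 - e) *\<^sub>R R + e *\<^sub>R M = P"
      using e1 by (intro poly_mapping_eqI) (auto simp: R_def lookup_add lookup_minus field_simps)
    finally show ?thesis .
  qed
qed

lemma compact_graph_iff_convex_hull:
  "compact_graph G \<longleftrightarrow> fractional_automorphisms G = convex hull (automorphism_points G)"
  by (simp only: compact_graph_def integer_hull_def integral_fractional_automorphisms)

text \<open>Every matrix is supported on \<open>UNIV\<close>, so Birkhoff's argument applies to all
  fractional automorphisms.\<close>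

lemma compact_graphI:
  assumes "\<And>Q. fractional_iso G G Q \<Longrightarrow> positive_iso G G Q"
  shows "compact_graph G"
  unfolding compact_graph_iff_convex_hull
  using fractional_automorphism_in_convex_hull[of UNIV] assms convex_hull_automorphism_points_subset
  by (auto simp: supported_on_def)

text \<open>A permutation with positive weight in a convex combination lies in the support.\<close>

lemma compact_graph_positive_iso:
  assumes compact: "compact_graph G" and Q: "fractional_iso G G Q"
  shows "positive_iso G G Q"
    and "supported_on orbit_pairs Q"
proof -
  \<comment> \<open>\<open>Q\<close> is arbitrary outside the vertices; \<open>P\<close> is its
    restriction to them, as a point.\<close>
  define P where "P = (\<Sum>p\<in>matrix_index G. Poly_Mapping.single p (Q (fst p) (snd p)))"
  have lookup_P: "Poly_Mapping.lookup P (u, v) = (if (u, v) \<in> matrix_index G then Q u v else 0)" for u v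
  proof -
    have "Poly_Mapping.lookup P (u, v) = (\<Sum>p\<in>matrix_index G. if p = (u, v) then Q u v else 0)"
      unfolding P_def lookup_sum by (intro sum.cong) (auto simp: lookup_single when_def)
    then show ?thesis by (simp add: finite_matrix_index)
  qed
  have "fractional_iso G G (\<lambda>u v. Poly_Mapping.lookup P (u, v))"
    using Q by (subst fractional_iso_cong[where Q = Q]) (auto simp: lookup_P matrix_index_def)
  then have "P \<in> fractional_automorphisms G"
    by (auto simp: fractional_automorphisms_iff coord_space_iff lookup_P split: if_splits)
  then have "P \<in> convex hull (automorphism_points G)"
    using compact by (simp add: compact_graph_iff_convex_hull)
  then obtain w where w: "\<forall>x\<in>automorphism_points G. 0 \<le> w x" "sum w (automorphism_points G) = 1"
    "(\<Sum>x\<in>automorphism_points G. w x *\<^sub>R x) = P"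
    using convex_hull_finite[OF finite_automorphism_points] by auto
  have Q_eq: "Q u v = (\<Sum>x\<in>automorphism_points G. w x * Poly_Mapping.lookup x (u, v))"
    if "u \<in> pverts G" "v \<in> pverts G" for u v
    using arg_cong[OF w(3), of "\<lambda>x. Poly_Mapping.lookup x (u, v)"] that
    by (simp add: lookup_sum lookup_P matrix_index_def)
  have nonneg: "w x * Poly_Mapping.lookup x (u, v) \<ge> 0" if "x \<in> automorphism_points G" for x u v
    using w(1) that by (auto simp: automorphism_points_def lookup_perm_point)
  have "\<exists>x\<in>automorphism_points G. w x \<noteq> 0"
    using w(2) by (auto intro: ccontr)
  then obtain \<pi> where \<pi>: "iso_map G G \<pi>" "w (perm_point G \<pi>) \<noteq> 0"
    by (auto simp: automorphism_points_def)
  then have mem: "perm_point G \<pi> \<in> automorphism_points G" by (auto simp: automorphism_points_def)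
  have "Q u (\<pi> u) > 0" if u: "u \<in> pverts G" for u
  proof -
    have "0 < w (perm_point G \<pi>) * Poly_Mapping.lookup (perm_point G \<pi>) (u, \<pi> u)"
      using w(1) mem \<pi> u by (auto simp: lookup_perm_point less_le)
    also have "\<dots> \<le> (\<Sum>x\<in>automorphism_points G. w x * Poly_Mapping.lookup x (u, \<pi> u))"
      using mem finite_automorphism_points nonneg by (intro member_le_sum) auto
    also have "\<dots> = Q u (\<pi> u)"
      using u \<pi> by (intro Q_eq[symmetric]) (auto simp: iso_map_def bij_betwE)
    finally show ?thesis .
  qed
  then show "positive_iso G G Q" using \<pi> by (auto simp: positive_iso_def)
  show "supported_on orbit_pairs Q"
    unfolding supported_on_def
  proof (intro ballI impI)
    fix u v assume uv: "u \<in> pverts G" "v \<in> pverts G" "Q u v \<noteq> 0"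
    \<comment> \<open>A nonzero entry of the convex combination comes from a nonzero entry of some
      automorphism point.\<close>
    then obtain x where "x \<in> automorphism_points G" "Poly_Mapping.lookup x (u, v) \<noteq> 0"
      using Q_eq[of u v] by (metis (no_types, lifting) mult_zero_right sum.neutral)
    then show "(u, v) \<in> orbit_pairs"
      by (auto simp: orbit_pairs_def automorphism_points_def lookup_perm_point split: if_splits)
  qed
qed

end

section \<open>Exactness\<close>

text \<open>The generators of degree at most \<open>1\<close> are separated from the Boolean ones
  because they carry over to the theta body as equations.\<close>

definition automorphism_equations :: "'a pair_pre_digraph \<Rightarrow> ('a \<times> 'a) mpoly set" where
  "automorphism_equations G =
     {(\<Sum>l\<in>pverts G. pvar (i, l) * adj G l j) - (\<Sum>l\<in>pverts G. adj G i l * pvar (l, j))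
         | i j. i \<in> pverts G \<and> j \<in> pverts G}
      \<union> {(\<Sum>i\<in>pverts G. pvar (i, j)) - 1 | j. j \<in> pverts G}
      \<union> {(\<Sum>j\<in>pverts G. pvar (i, j)) - 1 | i. i \<in> pverts G}"

definition boolean_equations :: "'v set \<Rightarrow> 'v mpoly set" where
  "boolean_equations X = {pvar v ^ 2 - pvar v | v. v \<in> X}"

lemma automorphism_ideal_eq:
  "automorphism_ideal G =
     ideal_generated (matrix_index G) (automorphism_equations G \<union> boolean_equations (matrix_index G))"
proof -
  have "boolean_equations (matrix_index G) =
    {pvar (i, j) ^ 2 - pvar (i, j) | i j. i \<in> pverts G \<and> j \<in> pverts G}"
    by (auto simp: boolean_equations_def matrix_index_def)
  then show ?thesis
    by (simp only: automorphism_ideal_def automorphism_equations_def)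
qed

lemma automorphism_equations_poly_ring: "automorphism_equations G \<subseteq> poly_ring (matrix_index G)"
  unfolding automorphism_equations_def
  by (auto intro!: poly_ring_diff poly_ring_sum poly_ring_mult simp: matrix_index_def)

lemma boolean_equations_poly_ring: "boolean_equations X \<subseteq> poly_ring X"
  by (auto simp: boolean_equations_def intro!: poly_ring_diff poly_ring_power)

lemma automorphism_equations_degree:
  "b \<in> automorphism_equations G \<Longrightarrow> total_degree b \<le> 1"
  unfolding automorphism_equations_def
  by (auto intro!: total_degree_diff total_degree_sum simp del: One_nat_def)

text \<open>The right-hand side is the definition of a fractional automorphism up to nonnegativity
  and membership in the coordinate space.\<close>

lemma automorphism_equations_zero_iff:
  "(\<forall>b\<in>automorphism_equations G. peval b x = 0) \<longleftrightarrow>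
     (\<forall>i\<in>pverts G. \<forall>j\<in>pverts G.
        (\<Sum>l\<in>pverts G. Poly_Mapping.lookup x (i, l) * adj G l j) =
        (\<Sum>l\<in>pverts G. adj G i l * Poly_Mapping.lookup x (l, j))) \<and>
     (\<forall>j\<in>pverts G. (\<Sum>i\<in>pverts G. Poly_Mapping.lookup x (i, j)) = 1) \<and>
     (\<forall>i\<in>pverts G. (\<Sum>j\<in>pverts G. Poly_Mapping.lookup x (i, j)) = 1)"
proof -
  have "(\<forall>b\<in>automorphism_equations G. peval b x = 0) \<longleftrightarrow>
     (\<forall>i\<in>pverts G. \<forall>j\<in>pverts G.
        peval ((\<Sum>l\<in>pverts G. pvar (i, l) * adj G l j) - (\<Sum>l\<in>pverts G. adj G i l * pvar (l, j))) x = 0) \<and>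
     (\<forall>j\<in>pverts G. peval ((\<Sum>i\<in>pverts G. pvar (i, j)) - 1) x = 0) \<and>
     (\<forall>i\<in>pverts G. peval ((\<Sum>j\<in>pverts G. pvar (i, j)) - 1) x = 0)"
    unfolding automorphism_equations_def by blast
  then show ?thesis by simp
qed

lemma boolean_equations_zero_iff:
  "(\<forall>b\<in>boolean_equations X. peval b x = 0) \<longleftrightarrow>
     (\<forall>v\<in>X. Poly_Mapping.lookup x v = 0 \<or> Poly_Mapping.lookup x v = 1)"
proof -
  have "(\<forall>b\<in>boolean_equations X. peval b x = 0) \<longleftrightarrow> (\<forall>v\<in>X. peval (pvar v ^ 2 - pvar v) x = 0)"
    unfolding boolean_equations_def by blast
  then show ?thesis by (simp add: power2_eq_square)
qed

context pair_graph
begin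

text \<open>The Boolean equations make the entries of a zero nonnegative and integral, so a zero is
  an integral fractional automorphism.\<close>

lemma real_zeros_automorphism_ideal:
  "real_zeros (matrix_index G) (automorphism_ideal G) = automorphism_points G"
proof
  show "real_zeros (matrix_index G) (automorphism_ideal G) \<subseteq> automorphism_points G"
  proof
    fix x assume "x \<in> real_zeros (matrix_index G) (automorphism_ideal G)"
    then have coord: "x \<in> coord_space (matrix_index G)"
      and eq: "\<forall>b\<in>automorphism_equations G. peval b x = 0"
      and bool: "\<forall>v\<in>matrix_index G. Poly_Mapping.lookup x v = 0 \<or> Poly_Mapping.lookup x v = 1"
      by (auto simp: automorphism_ideal_eq real_zeros_ideal_generated simp flip: boolean_equations_zero_iff)
    have "Poly_Mapping.lookup x (i, j) \<ge> 0" if "i \<in> pverts G" "j \<in> pverts G" for i j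
      using bool[rule_format, of "(i, j)"] that by (auto simp: matrix_index_def)
    then have "x \<in> fractional_automorphisms G"
      using coord eq[unfolded automorphism_equations_zero_iff] by (simp add: fractional_automorphisms_def)
    moreover have "Poly_Mapping.lookup x v \<in> \<int>" for v
      using bool coord by (metis coord_space_iff Ints_0 Ints_1)
    ultimately show "x \<in> automorphism_points G" by (rule integral_fractional_automorphism)
  qed
  show "automorphism_points G \<subseteq> real_zeros (matrix_index G) (automorphism_ideal G)"
  proof
    fix x assume x: "x \<in> automorphism_points G"
    then have "x \<in> fractional_automorphisms G"
      using perm_point_fractional by (auto simp: automorphism_points_def)
    moreover from this have "\<forall>b\<in>automorphism_equations G. peval b x = 0"
      unfolding automorphism_equations_zero_iff by (simp add: fractional_automorphisms_def)
    moreover have "\<forall>b\<in>boolean_equations (matrix_index G). peval b x = 0"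
      unfolding boolean_equations_zero_iff using x by (auto simp: automorphism_points_def lookup_perm_point)
    ultimately show "x \<in> real_zeros (matrix_index G) (automorphism_ideal G)"
      by (auto simp: automorphism_ideal_eq real_zeros_ideal_generated fractional_automorphisms_def)
  qed
qed

text \<open>
  The entries of the variable matrix are squares modulo the ideal. Since the ideal is real radical,
  it contains every entry \<open>(u, v)\<close> for which no automorphism maps \<open>u\<close> to \<open>v\<close>.
\<close>

lemma theta_body_subset:
  assumes x: "x \<in> theta_body 1 (matrix_index G) (automorphism_ideal G)"
  shows "x \<in> fractional_automorphisms G"
    and "supported_on orbit_pairs (\<lambda>u v. Poly_Mapping.lookup x (u, v))"
proof -
  define X B where "X = matrix_index G" and "B = automorphism_equations G \<union> boolean_equations X"
  have I: "automorphism_ideal G = ideal_generated X B"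
    by (simp add: automorphism_ideal_eq X_def B_def)
  note x' = x[folded X_def, unfolded I]
  have bool: "pvar v ^ 2 - pvar v \<in> ideal_generated X B" if "v \<in> X" for v
    using that by (intro ideal_generated_superset) (unfold B_def boolean_equations_def, blast)
  have "peval b x = 0" if "b \<in> automorphism_equations G" for b
    using that automorphism_equations_poly_ring automorphism_equations_degree[OF that]
    by (intro theta_body_ideal_eq_0[OF x'] ideal_generated_superset) (auto simp: B_def X_def)
  moreover have "Poly_Mapping.lookup x (i, j) \<ge> 0" if "i \<in> pverts G" "j \<in> pverts G" for i j
  proof -
    have ij: "(i, j) \<in> X" using that by (simp add: X_def matrix_index_def)
    \<comment> \<open>The variable itself serves as the polynomial to be squared.\<close>
    have "pvar (i, j) - (\<Sum>h\<leftarrow>[pvar (i, j)]. h ^ 2) = - (pvar (i, j) ^ 2 - pvar (i, j))"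
      by simp
    also have "\<dots> \<in> ideal_generated X B"
      by (rule ideal_generated_uminus[OF bool[OF ij]])
    finally have "sos_mod 1 X (ideal_generated X B) (pvar (i, j))"
      using ij unfolding sos_mod_def by (intro exI[of _ "[pvar (i, j)]"]) (simp del: One_nat_def)
    then have "peval (pvar (i, j)) x \<ge> 0"
      using x' ij by (auto simp: theta_body_def simp del: peval_pvar One_nat_def)
    then show ?thesis by simp
  qed
  moreover have "x \<in> coord_space (matrix_index G)" using x by (simp add: theta_body_def)
  ultimately show "x \<in> fractional_automorphisms G"
    using automorphism_equations_zero_iff[of G x] by (simp add: fractional_automorphisms_def)
  show "supported_on orbit_pairs (\<lambda>u v. Poly_Mapping.lookup x (u, v))"
    unfolding supported_on_def
  proof (intro ballI impI, rule ccontr)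
    fix u v assume uv: "u \<in> pverts G" "v \<in> pverts G" "Poly_Mapping.lookup x (u, v) \<noteq> 0"
      and no: "(u, v) \<notin> orbit_pairs"
    have uvX: "(u, v) \<in> X" using uv by (simp add: X_def matrix_index_def)
    have "pvar (u, v) \<in> ideal_generated X B"
    proof (rule boolean_nullstellensatz)
      show "finite X" by (simp add: X_def finite_matrix_index)
      show "B \<subseteq> poly_ring X"
        using automorphism_equations_poly_ring boolean_equations_poly_ring by (auto simp: B_def X_def)
      show "peval (pvar (u, v)) y = 0" if "y \<in> real_zeros X (ideal_generated X B)" for y
        using that no real_zeros_automorphism_ideal
        by (auto simp: I X_def orbit_pairs_def automorphism_points_def lookup_perm_point)
    qed (use bool uvX in auto)
    \<comment> \<open>The variable has degree \<open>1\<close> and lies in the ideal, so this entry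
      of \<open>x\<close> would be zero.\<close>
    from theta_body_ideal_eq_0[OF x' this] show False
      using uv uvX by (simp del: One_nat_def)
  qed
qed

text \<open>The hull of the finite zero set is closed, and the theta body contains it by convexity.
  Conversely, points of the theta body are supported on \<open>orbit_pairs\<close>, so Birkhoff's
  argument applies to them.\<close>

lemma exact_graphI:
  assumes "\<And>Q. fractional_iso G G Q \<Longrightarrow> supported_on orbit_pairs Q \<Longrightarrow> positive_iso G G Q"
  shows "exact_graph G"
proof -
  have "closed (convex hull (automorphism_points G))"
    using finite_automorphism_points by (intro compact_imp_closed finite_imp_compact_convex_hull)
  then have "closure (convex hull (automorphism_points G)) = convex hull (automorphism_points G)"
    by (rule closure_closed)
  also have "\<dots> = theta_body 1 (matrix_index G) (automorphism_ideal G)"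
  proof
    show "convex hull (automorphism_points G) \<subseteq> theta_body 1 (matrix_index G) (automorphism_ideal G)"
      using real_zeros_subset_theta_body[of "matrix_index G" "automorphism_ideal G" 1]
      by (intro hull_minimal convex_theta_body) (simp add: real_zeros_automorphism_ideal)
    show "theta_body 1 (matrix_index G) (automorphism_ideal G) \<subseteq> convex hull (automorphism_points G)"
      using theta_body_subset assms fractional_automorphism_in_convex_hull by blast
  qed
  finally show ?thesis
    by (simp add: exact_graph_def exact_ideal_def real_zeros_automorphism_ideal)
qed

text \<open>Compactness puts an automorphism into the support of every fractional automorphism, in
  particular of those supported on the orbits.\<close>

lemma compact_imp_exact: "compact_graph G \<Longrightarrow> exact_graph G"
  using compact_graph_positive_iso(1) by (intro exact_graphI)

end

section \<open>Disjoint unions of regular graphs\<close>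

lemma pair_graphI:
  assumes "finite (pverts G)" "parcs G \<subseteq> pverts G \<times> pverts G"
    and "\<And>u v. (u, v) \<in> parcs G \<Longrightarrow> (v, u) \<in> parcs G" "\<And>u. (u, u) \<notin> parcs G"
  shows "pair_graph G"
proof
  show "finite (parcs G)" using assms(1,2) by (meson finite_SigmaI finite_subset)
  show "symmetric (with_proj G)" using assms(3) by (auto simp: symmetric_def intro: symI)
qed (use assms in auto)

lemma (in pair_graph) arc_sym: "(u, v) \<in> parcs G \<Longrightarrow> (v, u) \<in> parcs G"
  using pair_sym_arcs by (auto simp: symmetric_def dest: symD)

lemma (in pair_graph) adj_sym: "adj G u v = adj G v u"
  using arc_sym by (auto simp: adj_def)

text \<open>Connectivity is defined through the symmetric closure, which adds no arcs to an
  undirected graph.\<close>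

lemma (in pair_graph) parcs_mk_symmetric_self: "parcs (mk_symmetric (with_proj G)) = parcs G"
  using arc_sym by (force simp: parcs_mk_symmetric)

lemma (in pair_graph) connected_graph_induct:
  assumes "connected_graph G" "u \<in> pverts G" "v \<in> pverts G" "P u"
    and "\<And>a b. (a, b) \<in> parcs G \<Longrightarrow> P a \<Longrightarrow> P b"
  shows "P v"
proof -
  have "u \<rightarrow>\<^sup>*\<^bsub>with_proj (mk_symmetric (with_proj G))\<^esub> v"
    using assms(1-3) by (auto simp: connected_graph_def connected_def strongly_connected_def)
  then have "(u, v) \<in> rtrancl_on (pverts G) (parcs G)"
    by (simp add: reachable_def parcs_mk_symmetric_self)
  then show ?thesis
    by (rule rtrancl_on_induct) (use assms(4,5) in auto)
qed

text \<open>Paths from the root can be reversed, so any two vertices are joined through it.\<close>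

lemma (in pair_graph) connected_graphI:
  assumes "r \<in> pverts G" "\<And>v. v \<in> pverts G \<Longrightarrow> (r, v) \<in> (parcs G)\<^sup>*"
  shows "connected_graph G"
  unfolding connected_graph_def connected_def strongly_connected_def
proof (intro conjI ballI)
  interpret S: pair_wf_digraph "mk_symmetric (with_proj G)" by (rule wellformed_mk_symmetric)
  fix u v assume "u \<in> verts (with_proj (mk_symmetric (with_proj G)))"
    "v \<in> verts (with_proj (mk_symmetric (with_proj G)))"
  then have uv: "u \<in> pverts G" "v \<in> pverts G" by simp_all
  have "sym ((parcs G)\<^sup>*)" using arc_sym by (intro sym_rtrancl symI)
  then have "(u, v) \<in> (parcs G)\<^sup>*"
    using assms(2)[OF uv(1)] assms(2)[OF uv(2)] by (meson rtrancl_trans symD)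
  then show "u \<rightarrow>\<^sup>*\<^bsub>with_proj (mk_symmetric (with_proj G))\<^esub> v"
  proof induction
    case base
    show ?case using uv by (intro S.reachable_refl) simp
  next
    case (step y z)
    then show ?case
      by (intro S.reachable_adj_trans[OF step.IH]) (simp add: parcs_mk_symmetric_self)
  qed
qed (use assms in auto)

lemma (in pair_graph) sum_adj_regular:
  assumes "regular_graph k G" "u \<in> pverts G"
  shows "(\<Sum>v\<in>pverts G. adj G u v) = real k"
proof -
  have "out_arcs (with_proj G) u = Pair u ` {v \<in> pverts G. (u, v) \<in> parcs G}"
    by (auto simp: out_arcs_def dest: in_arcsD2)
  moreover have "k = card (out_arcs (with_proj G) u)"
    using assms by (simp add: regular_graph_def out_degree_def)
  ultimately have "k = card (Pair u ` {v \<in> pverts G. (u, v) \<in> parcs G})"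
    by simp
  also have "\<dots> = card {v \<in> pverts G. (u, v) \<in> parcs G}"
    by (intro card_image) (auto simp: inj_on_def)
  finally show ?thesis
    using pair_finite_verts by (simp add: adj_def of_bool_def sum.If_cases Int_def)
qed

text \<open>The maximum principle: the largest value spreads to all neighbours.\<close>

lemma (in pair_graph) degree_eigenvector_constant:
  assumes conn: "connected_graph G" and reg: "regular_graph k G"
    and eig: "\<And>u. u \<in> pverts G \<Longrightarrow> (\<Sum>l\<in>pverts G. adj G u l * f l) = real k * f u"
  shows "\<exists>c. \<forall>u\<in>pverts G. f u = c"
proof -
  note fin = pair_finite_verts
  have ne: "pverts G \<noteq> {}"
    using conn by (auto simp: connected_graph_def connected_def strongly_connected_def)
  define M where "M = Max (f ` pverts G)"
  have le: "f u \<le> M" if "u \<in> pverts G" for u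
    unfolding M_def using fin that by (intro Max_ge) auto
  have "M \<in> f ` pverts G" unfolding M_def using fin ne by (intro Max_in) auto
  then obtain r where r: "r \<in> pverts G" "f r = M" by auto
  have "f b = M" if ab: "(a, b) \<in> parcs G" "f a = M" for a b
  proof -
    have V: "a \<in> pverts G" "b \<in> pverts G" using ab by (auto dest: in_arcsD1 in_arcsD2)
    \<comment> \<open>The terms are nonnegative and sum to \<open>k * M - k * M\<close>, so each
      vanishes, in particular the one at the neighbour \<open>b\<close>.\<close>
    have "(\<Sum>l\<in>pverts G. adj G a l * (M - f l)) =
      (\<Sum>l\<in>pverts G. adj G a l) * M - (\<Sum>l\<in>pverts G. adj G a l * f l)"
      by (simp add: right_diff_distrib sum_subtractf sum_distrib_right)
    also have "\<dots> = 0" using sum_adj_regular[OF reg V(1)] eig[OF V(1)] ab by simp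
    finally have "adj G a b * (M - f b) = 0"
      using fin V le by (subst (asm) sum_nonneg_eq_0_iff) (auto simp: adj_def)
    then show "f b = M" using ab by (simp add: adj_def)
  qed
  then have "f u = M" if "u \<in> pverts G" for u
    using connected_graph_induct[OF conn r(1) that, of "\<lambda>u. f u = M"] r(2) by blast
  then show ?thesis by blast
qed

text \<open>Applied to the all-ones vectors, the intertwining relation makes the row sums an
  eigenvector of \<open>G\<close> and, by symmetry of the adjacency matrices, the column sums one of
  \<open>H\<close>, both for the eigenvalue \<open>k\<close>. Summing all entries in both orders
  relates the two constants.\<close>

lemma intertwiner_sums_constant:
  fixes Q :: "'a \<Rightarrow> 'b \<Rightarrow> real"
  assumes G: "pair_graph G" "connected_graph G" "regular_graph k G"
    and H: "pair_graph H" "connected_graph H" "regular_graph k H"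
    and Q: "\<And>u v. u \<in> pverts G \<Longrightarrow> v \<in> pverts H \<Longrightarrow>
      (\<Sum>l\<in>pverts H. Q u l * adj H l v) = (\<Sum>l\<in>pverts G. adj G u l * Q l v)"
  shows "\<exists>r c :: real. (\<forall>u\<in>pverts G. (\<Sum>v\<in>pverts H. Q u v) = r) \<and> (\<forall>v\<in>pverts H. (\<Sum>u\<in>pverts G. Q u v) = c)
    \<and> real (card (pverts G)) * r = real (card (pverts H)) * c"
proof -
  interpret G: pair_graph G by fact
  interpret H: pair_graph H by fact
  have "\<exists>r. \<forall>u\<in>pverts G. (\<Sum>v\<in>pverts H. Q u v) = r"
  proof (rule G.degree_eigenvector_constant[OF G(2,3)])
    fix u assume u: "u \<in> pverts G"
    have "(\<Sum>l\<in>pverts G. adj G u l * (\<Sum>v\<in>pverts H. Q l v)) =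
      (\<Sum>v\<in>pverts H. \<Sum>l\<in>pverts G. adj G u l * Q l v)"
      by (subst sum.swap) (simp add: sum_distrib_left)
    also have "\<dots> = (\<Sum>v\<in>pverts H. \<Sum>l\<in>pverts H. Q u l * adj H l v)"
      using u by (simp add: Q)
    also have "\<dots> = (\<Sum>l\<in>pverts H. Q u l * (\<Sum>v\<in>pverts H. adj H l v))"
      by (subst sum.swap) (simp add: sum_distrib_left)
    also have "\<dots> = real k * (\<Sum>v\<in>pverts H. Q u v)"
      by (simp add: H.sum_adj_regular[OF H(3)] sum_distrib_left mult.commute)
    finally show "(\<Sum>l\<in>pverts G. adj G u l * (\<Sum>v\<in>pverts H. Q l v)) = real k * (\<Sum>v\<in>pverts H. Q u v)" .
  qed
  then obtain r where r: "\<forall>u\<in>pverts G. (\<Sum>v\<in>pverts H. Q u v) = r" by blast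
  have "\<exists>c. \<forall>v\<in>pverts H. (\<Sum>u\<in>pverts G. Q u v) = c"
  proof (rule H.degree_eigenvector_constant[OF H(2,3)])
    fix v assume v: "v \<in> pverts H"
    have "(\<Sum>l\<in>pverts H. adj H v l * (\<Sum>u\<in>pverts G. Q u l)) =
      (\<Sum>u\<in>pverts G. \<Sum>l\<in>pverts H. Q u l * adj H l v)"
      by (subst sum.swap) (simp add: sum_distrib_left H.adj_sym[of v] mult.commute)
    also have "\<dots> = (\<Sum>u\<in>pverts G. \<Sum>l\<in>pverts G. adj G u l * Q l v)"
      using v by (simp add: Q)
    also have "\<dots> = (\<Sum>l\<in>pverts G. (\<Sum>u\<in>pverts G. adj G l u) * Q l v)"
      by (subst sum.swap) (simp add: sum_distrib_right G.adj_sym)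
    also have "\<dots> = real k * (\<Sum>u\<in>pverts G. Q u v)"
      by (simp add: G.sum_adj_regular[OF G(3)] sum_distrib_left)
    finally show "(\<Sum>l\<in>pverts H. adj H v l * (\<Sum>u\<in>pverts G. Q u l)) = real k * (\<Sum>u\<in>pverts G. Q u v)" .
  qed
  then obtain c where c: "\<forall>v\<in>pverts H. (\<Sum>u\<in>pverts G. Q u v) = c" by blast
  have "card (pverts G) * r = (\<Sum>u\<in>pverts G. \<Sum>v\<in>pverts H. Q u v)" using r by simp
  also have "\<dots> = (\<Sum>v\<in>pverts H. \<Sum>u\<in>pverts G. Q u v)" by (rule sum.swap)
  also have "\<dots> = card (pverts H) * c" using c by simp
  finally show ?thesis using r c by blast
qed

text \<open>
  The embeddings \<open>e\<close> allow the union to live on any vertex type, in particular on the natural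
  numbers as well as on the tagged vertices of \<^const>\<open>disjoint_union\<close>.
\<close>

locale regular_compact_union =
  fixes k m :: nat and Gs :: "nat \<Rightarrow> 'a pair_pre_digraph" and e :: "nat \<Rightarrow> 'a \<Rightarrow> 'b"
    and G :: "'b pair_pre_digraph"
  assumes fam: "regular_connected_compact_family k m Gs"
    and inj_e: "inj_on (\<lambda>(i, u). e i u) (SIGMA i:{1..m}. pverts (Gs i))"
    and verts: "pverts G = (\<lambda>(i, u). e i u) ` (SIGMA i:{1..m}. pverts (Gs i))"
    and arcs: "parcs G = {(e i u, e i v) | i u v. i \<in> {1..m} \<and> (u, v) \<in> parcs (Gs i)}"
begin

abbreviation "I \<equiv> {1..m}"
abbreviation "V i \<equiv> pverts (Gs i)"

lemma component:
  assumes "i \<in> I"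
  shows "pair_graph (Gs i)" "regular_graph k (Gs i)" "connected_graph (Gs i)" "compact_graph (Gs i)"
    and "finite (V i)" "V i \<noteq> {}"
proof -
  show *: "pair_graph (Gs i)" "regular_graph k (Gs i)" "connected_graph (Gs i)" "compact_graph (Gs i)"
    using fam assms by (auto simp: regular_connected_compact_family_def)
  interpret pair_graph "Gs i" by fact
  show "finite (V i)" by (rule pair_finite_verts)
  show "V i \<noteq> {}"
    using *(3) by (auto simp: connected_graph_def connected_def strongly_connected_def)
qed

lemma component_arcs:
  assumes "i \<in> I" "(u, v) \<in> parcs (Gs i)"
  shows "u \<in> V i" "v \<in> V i" "(v, u) \<in> parcs (Gs i)" "u \<noteq> v"
proof -
  interpret pair_graph "Gs i" by (rule component) fact
  show "u \<in> V i" "v \<in> V i" "(v, u) \<in> parcs (Gs i)" "u \<noteq> v"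
    using assms(2) in_arcsD1 in_arcsD2 arc_sym no_loops' by blast+
qed

lemma e_eq_iff:
  assumes "i \<in> I" "j \<in> I" "u \<in> V i" "v \<in> V j"
  shows "e i u = e j v \<longleftrightarrow> i = j \<and> u = v"
  using inj_onD[OF inj_e, of "(i, u)" "(j, v)"] assms by auto

lemma e_in_verts: "i \<in> I \<Longrightarrow> u \<in> V i \<Longrightarrow> e i u \<in> pverts G"
  by (force simp: verts)

lemma vertsE:
  assumes "x \<in> pverts G"
  obtains i u where "i \<in> I" "u \<in> V i" "x = e i u"
  using assms by (auto simp: verts)

lemma e_arc_iff:
  assumes "i \<in> I" "j \<in> I" "u \<in> V i" "v \<in> V j"
  shows "(e i u, e j v) \<in> parcs G \<longleftrightarrow> i = j \<and> (u, v) \<in> parcs (Gs i)"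
proof
  assume "(e i u, e j v) \<in> parcs G"
  then obtain i' u' v' where *: "i' \<in> I" "(u', v') \<in> parcs (Gs i')" "e i u = e i' u'" "e j v = e i' v'"
    by (auto simp: arcs)
  then show "i = j \<and> (u, v) \<in> parcs (Gs i)"
    using e_eq_iff[OF assms(1) *(1) assms(3)] e_eq_iff[OF assms(2) *(1) assms(4)]
      component_arcs[OF *(1,2)] by auto
next
  assume "i = j \<and> (u, v) \<in> parcs (Gs i)"
  then show "(e i u, e j v) \<in> parcs G" using assms(1) unfolding arcs by blast
qed

lemma adj_e:
  assumes "i \<in> I" "j \<in> I" "u \<in> V i" "v \<in> V j"
  shows "adj G (e i u) (e j v) = (if i = j then adj (Gs i) u v else 0)"
  using e_arc_iff[OF assms] by (auto simp: adj_def)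

lemma sum_verts: "(\<Sum>x\<in>pverts G. f x) = (\<Sum>i\<in>I. \<Sum>u\<in>V i. f (e i u))"
proof -
  have "(\<Sum>x\<in>pverts G. f x) = (\<Sum>(i, u)\<in>(SIGMA i:I. V i). f (e i u))"
    unfolding verts using sum.reindex[OF inj_e, of f] by (simp add: case_prod_unfold o_def)
  also have "\<dots> = (\<Sum>i\<in>I. \<Sum>u\<in>V i. f (e i u))"
    using component(5) by (intro sum.Sigma[symmetric]) auto
  finally show ?thesis .
qed

lemma pair_graph_union: "pair_graph G"
proof (rule pair_graphI)
  show "finite (pverts G)"
    unfolding verts using component(5) by (intro finite_imageI finite_SigmaI) auto
  show "parcs G \<subseteq> pverts G \<times> pverts G"
    using e_in_verts component_arcs unfolding arcs by blast
  show "(v, u) \<in> parcs G" if "(u, v) \<in> parcs G" for u v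
    using that component_arcs unfolding arcs by blast
  show "(x, x) \<notin> parcs G" for x
  proof
    assume "(x, x) \<in> parcs G"
    then obtain i u v where "i \<in> I" "(u, v) \<in> parcs (Gs i)" "e i u = e i v"
      by (auto simp: arcs)
    then show False using component_arcs e_eq_iff by metis
  qed
qed

sublocale pair_graph G by (rule pair_graph_union)

text \<open>An automorphism maps components into components, and so does its inverse.\<close>

lemma automorphism_imp_component_iso:
  assumes \<Phi>: "iso_map G G \<Phi>" and i: "i \<in> I" "u0 \<in> V i" and j: "j \<in> I" "v0 \<in> V j"
    and e0: "\<Phi> (e i u0) = e j v0"
  shows "\<exists>\<psi>. iso_map (Gs i) (Gs j) \<psi>"
proof -
  \<comment> \<open>The map and both indices are kept general because the claim is applied to
    \<open>\<Phi>\<close> and, for surjectivity, to its inverse.\<close>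
  have step: "\<exists>w'\<in>V j. \<Psi> (e i w) = e j w'"
    if \<Psi>: "iso_map G G \<Psi>" and ij: "i \<in> I" "u \<in> V i" "j \<in> I" "v \<in> V j" "\<Psi> (e i u) = e j v" "w \<in> V i"
    for \<Psi> i j u v w
  proof -
    interpret C: pair_graph "Gs i" by (rule component) fact
    show ?thesis
    proof (rule C.connected_graph_induct[OF component(3)[OF ij(1)] ij(2) ij(6)])
      show "\<exists>w'\<in>V j. \<Psi> (e i u) = e j w'" using ij by blast
      fix a b assume ab: "(a, b) \<in> parcs (Gs i)" and "\<exists>w'\<in>V j. \<Psi> (e i a) = e j w'"
      then obtain w' where w': "w' \<in> V j" "\<Psi> (e i a) = e j w'" by blast
      note V = component_arcs(1,2)[OF ij(1) ab]
      have "(e i a, e i b) \<in> parcs G" using ab V ij e_arc_iff by blast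
      then have arc: "(\<Psi> (e i a), \<Psi> (e i b)) \<in> parcs G"
        using \<Psi> e_in_verts[OF ij(1)] V by (auto simp: iso_map_def)
      obtain j' b' where b': "j' \<in> I" "b' \<in> V j'" "\<Psi> (e i b) = e j' b'"
        using in_arcsD2[OF arc] by (rule vertsE)
      then have "j' = j" using arc w' ij(3) e_arc_iff[of j j' w' b'] by auto
      then show "\<exists>w'\<in>V j. \<Psi> (e i b) = e j w'" using b' by blast
    qed
  qed
  have bij: "bij_betw \<Phi> (pverts G) (pverts G)" using \<Phi> by (simp add: iso_map_def)
  obtain \<psi> where \<psi>: "\<And>w. w \<in> V i \<Longrightarrow> \<psi> w \<in> V j \<and> \<Phi> (e i w) = e j (\<psi> w)"
    using step[OF \<Phi> i j e0] by metis
  have "inj_on \<psi> (V i)"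
  proof (rule inj_onI)
    fix a b assume ab: "a \<in> V i" "b \<in> V i" "\<psi> a = \<psi> b"
    then have "\<Phi> (e i a) = \<Phi> (e i b)" using \<psi> by simp
    then have "e i a = e i b" using bij e_in_verts i ab by (auto simp: bij_betw_def dest: inj_onD)
    then show "a = b" using e_eq_iff i ab by simp
  qed
  moreover have "\<psi> ` V i = V j"
  proof
    show "\<psi> ` V i \<subseteq> V j" using \<psi> by auto
    show "V j \<subseteq> \<psi> ` V i"
    proof
      fix w' assume w': "w' \<in> V j"
      define \<Phi>' where "\<Phi>' = the_inv_into (pverts G) \<Phi>"
      have "\<Phi>' (e j v0) = e i u0"
        using bij e_in_verts i e0 unfolding \<Phi>'_def by (metis bij_betw_def the_inv_into_f_f)
      then obtain w where w: "w \<in> V i" "\<Phi>' (e j w') = e i w"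
        using step[OF iso_map_inv[OF \<Phi>, folded \<Phi>'_def] j i _ w'] by blast
      then have "e j w' = \<Phi> (e i w)"
        using f_the_inv_into_f_bij_betw[OF bij] e_in_verts[OF j(1) w'] unfolding \<Phi>'_def by metis
      then have "w' = \<psi> w" using \<psi>[OF w(1)] e_eq_iff j w' by simp
      then show "w' \<in> \<psi> ` V i" using w by blast
    qed
  qed
  moreover have "(a, b) \<in> parcs (Gs i) \<longleftrightarrow> (\<psi> a, \<psi> b) \<in> parcs (Gs j)" if "a \<in> V i" "b \<in> V i" for a b
  proof -
    have "(a, b) \<in> parcs (Gs i) \<longleftrightarrow> (e i a, e i b) \<in> parcs G"
      using that i e_arc_iff by simp
    also have "\<dots> \<longleftrightarrow> (\<Phi> (e i a), \<Phi> (e i b)) \<in> parcs G"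
      using \<Phi> that i e_in_verts by (simp add: iso_map_def)
    also have "\<dots> \<longleftrightarrow> (\<psi> a, \<psi> b) \<in> parcs (Gs j)"
      using \<psi> that j e_arc_iff by simp
    finally show ?thesis .
  qed
  ultimately show ?thesis
    by (auto simp: iso_map_def bij_betw_def)
qed

lemma orbit_pairs_imp_component_iso:
  assumes "i \<in> I" "u \<in> V i" "j \<in> I" "v \<in> V j" and orbit: "(e i u, e j v) \<in> orbit_pairs"
  shows "\<exists>\<psi>. iso_map (Gs i) (Gs j) \<psi>"
proof -
  obtain \<Phi> where "iso_map G G \<Phi>" "\<Phi> (e i u) = e j v"
    using orbit unfolding orbit_pairs_def by auto
  then show ?thesis using assms(1-4) by (intro automorphism_imp_component_iso)
qed

text \<open>
  The block sums of \<open>P\<close> form a doubly stochastic matrix on the components, so Hall's theorem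
  provides a permutation of the components whose blocks are nonzero; such a block is a multiple of a
  fractional isomorphism between compact graphs.
\<close>

lemma union_positive_iso:
  assumes P: "fractional_iso G G P"
    and iso: "\<And>i j u v. i \<in> I \<Longrightarrow> j \<in> I \<Longrightarrow> u \<in> V i \<Longrightarrow> v \<in> V j \<Longrightarrow> P (e i u) (e j v) \<noteq> 0 \<Longrightarrow>
      \<exists>\<psi>. iso_map (Gs i) (Gs j) \<psi>"
  shows "positive_iso G G P"
proof -
  define Q where "Q i j u v = P (e i u) (e j v)" for i j u v
  have nonneg: "Q i j u v \<ge> 0" if "i \<in> I" "j \<in> I" "u \<in> V i" "v \<in> V j" for i j u v
    using P that e_in_verts by (simp add: fractional_iso_def Q_def)
  \<comment> \<open>The adjacency matrix of the union is block diagonal, so each side of the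
    relation for \<open>P\<close> keeps a single block.\<close>
  have comm: "(\<Sum>l\<in>V j. Q i j u l * adj (Gs j) l v) = (\<Sum>l\<in>V i. adj (Gs i) u l * Q i j l v)"
    if ij: "i \<in> I" "j \<in> I" and uv: "u \<in> V i" "v \<in> V j" for i j u v
  proof -
    have "(\<Sum>x\<in>pverts G. P (e i u) x * adj G x (e j v)) =
      (\<Sum>j'\<in>I. if j' = j then \<Sum>l\<in>V j'. Q i j' u l * adj (Gs j') l v else 0)"
      unfolding sum_verts using ij uv by (intro sum.cong refl) (auto simp: adj_e Q_def)
    also have "\<dots> = (\<Sum>l\<in>V j. Q i j u l * adj (Gs j) l v)" using ij by simp
    finally have 1: "(\<Sum>x\<in>pverts G. P (e i u) x * adj G x (e j v)) = \<dots>" .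
    have "(\<Sum>x\<in>pverts G. adj G (e i u) x * P x (e j v)) =
      (\<Sum>i'\<in>I. if i' = i then \<Sum>l\<in>V i'. adj (Gs i') u l * Q i' j l v else 0)"
      unfolding sum_verts using ij uv by (intro sum.cong refl) (auto simp: adj_e Q_def)
    also have "\<dots> = (\<Sum>l\<in>V i. adj (Gs i) u l * Q i j l v)" using ij by simp
    finally have 2: "(\<Sum>x\<in>pverts G. adj G (e i u) x * P x (e j v)) = \<dots>" .
    show ?thesis
      using 1 2 P e_in_verts ij uv by (simp add: fractional_iso_def)
  qed
  \<comment> \<open>A zero block has constant \<open>0\<close>. Otherwise the two components are
    isomorphic, hence of equal size, and the double count identifies the row constant with the
    column constant.\<close>
  have "\<exists>r. (\<forall>u\<in>V i. (\<Sum>v\<in>V j. Q i j u v) = r) \<and> (\<forall>v\<in>V j. (\<Sum>u\<in>V i. Q i j u v) = r)"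
    if ij: "i \<in> I" "j \<in> I" for i j
  proof (cases "\<exists>u\<in>V i. \<exists>v\<in>V j. Q i j u v \<noteq> 0")
    case True
    then obtain \<psi> where "iso_map (Gs i) (Gs j) \<psi>" using iso ij unfolding Q_def by blast
    then have "card (V i) = card (V j)"
      by (auto simp: iso_map_def dest: bij_betw_same_card)
    moreover have "card (V j) > 0" using component(5,6)[OF ij(2)] by (simp add: card_gt_0_iff)
    ultimately show ?thesis
      using intertwiner_sums_constant[OF component(1,3,2)[OF ij(1)] component(1,3,2)[OF ij(2)] comm[OF ij]]
      by auto
  qed (intro exI[of _ 0], auto)
  then obtain r where r: "\<And>i j u. i \<in> I \<Longrightarrow> j \<in> I \<Longrightarrow> u \<in> V i \<Longrightarrow> (\<Sum>v\<in>V j. Q i j u v) = r i j"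
    and c: "\<And>i j v. i \<in> I \<Longrightarrow> j \<in> I \<Longrightarrow> v \<in> V j \<Longrightarrow> (\<Sum>u\<in>V i. Q i j u v) = r i j"
    by metis
  have "\<exists>\<sigma>. bij_betw \<sigma> I I \<and> (\<forall>i\<in>I. r i (\<sigma> i) > 0)"
  proof (rule doubly_stochastic_permutation)
    fix i assume i: "i \<in> I"
    obtain u where u: "u \<in> V i" using component(6)[OF i] by blast
    show "r i j \<ge> 0" if j: "j \<in> I" for j
      using r[OF i j u] nonneg[OF i j u] by (metis sum_nonneg)
    have "(\<Sum>j\<in>I. r i j) = (\<Sum>x\<in>pverts G. P (e i u) x)"
      unfolding sum_verts using r[OF i _ u] by (simp add: Q_def)
    then show "(\<Sum>j\<in>I. r i j) = 1" using P e_in_verts[OF i u] by (simp add: fractional_iso_def)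
    have "(\<Sum>j\<in>I. r j i) = (\<Sum>x\<in>pverts G. P x (e i u))"
      unfolding sum_verts using c[OF _ i u] by (simp add: Q_def)
    then show "(\<Sum>j\<in>I. r j i) = 1" using P e_in_verts[OF i u] by (simp add: fractional_iso_def)
  qed simp
  then obtain \<sigma> where \<sigma>: "bij_betw \<sigma> I I" "\<And>i. i \<in> I \<Longrightarrow> r i (\<sigma> i) > 0" by blast
  have \<sigma>_in: "\<sigma> i \<in> I" if "i \<in> I" for i using \<sigma>(1) that by (rule bij_betw_apply)
  have "\<exists>\<pi>. iso_map (Gs i) (Gs (\<sigma> i)) \<pi> \<and> (\<forall>u\<in>V i. Q i (\<sigma> i) u (\<pi> u) > 0)" if i: "i \<in> I" for i
  proof -
    \<comment> \<open>\<open>s\<close> is the common row and column sum of the chosen block;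
      dividing by it produces a fractional isomorphism.\<close>
    define j s where "j = \<sigma> i" and "s = r i (\<sigma> i)"
    have j: "j \<in> I" and s: "s > 0" using \<sigma>_in \<sigma>(2) i by (auto simp: j_def s_def)
    obtain u where u: "u \<in> V i" using component(6)[OF i] by blast
    have "(\<Sum>v\<in>V j. Q i j u v) \<noteq> 0" using r[OF i j u] s by (simp add: j_def s_def)
    then obtain v where "v \<in> V j" "Q i j u v \<noteq> 0" by (meson sum.neutral)
    then obtain \<psi> where \<psi>: "iso_map (Gs i) (Gs j) \<psi>" using iso[OF i j u] by (auto simp: Q_def)
    have "fractional_iso (Gs i) (Gs j) (\<lambda>u v. Q i j u v / s)"
      unfolding fractional_iso_def
    proof (intro conjI ballI)
      fix u v assume uv: "u \<in> V i" "v \<in> V j"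
      show "(\<Sum>l\<in>V j. Q i j u l / s * adj (Gs j) l v) = (\<Sum>l\<in>V i. adj (Gs i) u l * (Q i j l v / s))"
        using comm[OF i j uv] by (simp add: sum_divide_distrib[symmetric])
      show "Q i j u v / s \<ge> 0" using nonneg[OF i j uv] s by simp
    qed (use r[OF i j] c[OF i j] s in \<open>auto simp: sum_divide_distrib[symmetric] j_def s_def\<close>)
    moreover have "positive_iso (Gs i) (Gs i) R" if "fractional_iso (Gs i) (Gs i) R" for R
      using pair_graph.compact_graph_positive_iso(1)[OF component(1,4)[OF i] that] .
    ultimately have "positive_iso (Gs i) (Gs j) (\<lambda>u v. Q i j u v / s)"
      using positive_iso_transport[OF \<psi>] by blast
    then show ?thesis using s by (auto simp: positive_iso_def j_def zero_less_divide_iff)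
  qed
  then obtain \<pi> where \<pi>: "\<And>i. i \<in> I \<Longrightarrow> iso_map (Gs i) (Gs (\<sigma> i)) (\<pi> i)"
    and pos: "\<And>i u. i \<in> I \<Longrightarrow> u \<in> V i \<Longrightarrow> Q i (\<sigma> i) u (\<pi> i u) > 0"
    by metis
  have \<pi>_in: "\<pi> i u \<in> V (\<sigma> i)" if "i \<in> I" "u \<in> V i" for i u
    using \<pi>[OF that(1)] that(2) by (auto simp: iso_map_def bij_betwE)
  \<comment> \<open>\<open>\<Theta>\<close> glues the local isomorphisms: it decodes a vertex into a
    component and a local vertex, then moves these by \<open>\<sigma>\<close> and
    \<open>\<pi> i\<close>.\<close>
  define \<Theta> where "\<Theta> x = (case the_inv_into (SIGMA i:I. V i) (\<lambda>(i, u). e i u) x of (i, u) \<Rightarrow> e (\<sigma> i) (\<pi> i u))" for x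
  have \<Theta>: "\<Theta> (e i u) = e (\<sigma> i) (\<pi> i u)" if "i \<in> I" "u \<in> V i" for i u
    using the_inv_into_f_f[OF inj_e, of "(i, u)"] that by (simp add: \<Theta>_def)
  have "\<Theta> ` pverts G \<subseteq> pverts G"
    using \<Theta> \<sigma>_in \<pi>_in e_in_verts by (auto elim!: vertsE)
  moreover have "inj_on \<Theta> (pverts G)"
  proof (rule inj_onI)
    fix x y assume "x \<in> pverts G" "y \<in> pverts G" and eq: "\<Theta> x = \<Theta> y"
    then obtain i u j v where x: "i \<in> I" "u \<in> V i" "x = e i u" and y: "j \<in> I" "v \<in> V j" "y = e j v"
      by (metis vertsE)
    have "\<sigma> i = \<sigma> j" "\<pi> i u = \<pi> j v"
      using eq x y \<Theta> e_eq_iff \<sigma>_in \<pi>_in by auto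
    moreover from this(1) have "i = j" using \<sigma>(1) x y by (auto simp: bij_betw_def dest: inj_onD)
    ultimately show "x = y"
      using \<pi>[OF x(1)] x y by (auto simp: iso_map_def bij_betw_def dest: inj_onD)
  qed
  ultimately have "bij_betw \<Theta> (pverts G) (pverts G)"
    unfolding bij_betw_def using endo_inj_surj[OF pair_finite_verts] by blast
  moreover have "(x, y) \<in> parcs G \<longleftrightarrow> (\<Theta> x, \<Theta> y) \<in> parcs G" if xy: "x \<in> pverts G" "y \<in> pverts G" for x y
  proof -
    obtain i u j v where x: "i \<in> I" "u \<in> V i" "x = e i u" and y: "j \<in> I" "v \<in> V j" "y = e j v"
      using xy by (metis vertsE)
    have "(\<Theta> x, \<Theta> y) \<in> parcs G \<longleftrightarrow> \<sigma> i = \<sigma> j \<and> (\<pi> i u, \<pi> j v) \<in> parcs (Gs (\<sigma> i))"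
      using x y \<Theta> e_arc_iff \<sigma>_in \<pi>_in by simp
    also have "\<dots> \<longleftrightarrow> i = j \<and> (u, v) \<in> parcs (Gs i)"
    proof -
      have "\<sigma> i = \<sigma> j \<longleftrightarrow> i = j" using \<sigma>(1) x y by (auto simp: bij_betw_def dest: inj_onD)
      then show ?thesis using \<pi>[OF x(1)] x y by (auto simp: iso_map_def)
    qed
    also have "\<dots> \<longleftrightarrow> (x, y) \<in> parcs G" using x y e_arc_iff by simp
    finally show ?thesis by simp
  qed
  ultimately have "iso_map G G \<Theta>" by (simp add: iso_map_def)
  moreover have "P x (\<Theta> x) > 0" if "x \<in> pverts G" for x
    using that pos \<Theta> by (auto simp: Q_def elim!: vertsE)
  ultimately show ?thesis by (auto simp: positive_iso_def)
qed

text \<open>For a matrix supported on the orbits, a nonzero block joins components that some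
  automorphism maps onto each other, so they are isomorphic.\<close>

lemma exact_union: "exact_graph G"
proof (rule exact_graphI)
  fix Q assume Q: "fractional_iso G G Q" "supported_on orbit_pairs Q"
  show "positive_iso G G Q"
  proof (rule union_positive_iso[OF Q(1)])
    fix i j u v assume *: "i \<in> I" "j \<in> I" "u \<in> V i" "v \<in> V j" "Q (e i u) (e j v) \<noteq> 0"
    have "(e i u, e j v) \<in> orbit_pairs"
      using Q(2) *(5) e_in_verts[OF *(1,3)] e_in_verts[OF *(2,4)] unfolding supported_on_def by blast
    then show "\<exists>\<psi>. iso_map (Gs i) (Gs j) \<psi>"
      by (rule orbit_pairs_imp_component_iso[OF *(1,3,2,4)])
  qed
qed

text \<open>
  For non-isomorphic components the matrix with all entries \<open>1 / n\<close> is a fractional automorphism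
  that is not supported on the orbits.
\<close>

lemma compact_union_iff:
  "compact_graph G \<longleftrightarrow> (\<forall>i\<in>I. \<forall>j\<in>I. graph_iso (Gs i) (Gs j))"
proof
  assume "\<forall>i\<in>I. \<forall>j\<in>I. graph_iso (Gs i) (Gs j)"
  \<comment> \<open>Now the condition on blocks in \<open>union_positive_iso\<close> holds for every
    matrix.\<close>
  then have "\<exists>\<psi>. iso_map (Gs i) (Gs j) \<psi>" if "i \<in> I" "j \<in> I" for i j
    using that graph_iso_iff component(1) by blast
  then show "compact_graph G"
    by (intro compact_graphI union_positive_iso)
next
  assume compact: "compact_graph G"
  show "\<forall>i\<in>I. \<forall>j\<in>I. graph_iso (Gs i) (Gs j)"
  proof (intro ballI)
    fix i j assume ij: "i \<in> I" "j \<in> I"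
    obtain u v where uv: "u \<in> V i" "v \<in> V j" using component(6) ij by blast
    define n where "n = card (pverts G)"
    have n: "n > 0"
      using e_in_verts[OF ij(1) uv(1)] pair_finite_verts by (auto simp: n_def card_gt_0_iff)
    \<comment> \<open>The union is again \<open>k\<close>-regular, which is why a constant matrix
      commutes with its adjacency matrix.\<close>
    have deg: "(\<Sum>y\<in>pverts G. adj G x y) = real k" if x_in: "x \<in> pverts G" for x
    proof -
      obtain a w where x: "a \<in> I" "w \<in> V a" "x = e a w" using x_in by (rule vertsE)
      interpret C: pair_graph "Gs a" by (rule component) fact
      have "(\<Sum>y\<in>pverts G. adj G x y) = (\<Sum>b\<in>I. if b = a then \<Sum>y\<in>V b. adj (Gs b) w y else 0)"
        unfolding sum_verts x(3) using x by (intro sum.cong refl) (auto simp: adj_e)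
      also have "\<dots> = real k" using x C.sum_adj_regular[OF component(2)] by simp
      finally show ?thesis .
    qed
    have "fractional_iso G G (\<lambda>_ _. 1 / n)"
      unfolding fractional_iso_def
    proof (intro conjI ballI)
      fix x y assume "x \<in> pverts G" "y \<in> pverts G"
      then show "(\<Sum>l\<in>pverts G. 1 / n * adj G l y) = (\<Sum>l\<in>pverts G. adj G x l * (1 / n))"
        using deg[of x] deg[of y] by (simp add: sum_divide_distrib[symmetric] adj_sym[of _ y])
    qed (use n in \<open>auto simp: n_def\<close>)
    then have "(e i u, e j v) \<in> orbit_pairs"
      using compact_graph_positive_iso(2)[OF compact, of "\<lambda>_ _. 1 / n"]
        e_in_verts[OF ij(1) uv(1)] e_in_verts[OF ij(2) uv(2)] n by (simp add: supported_on_def)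
    then obtain \<psi> where "iso_map (Gs i) (Gs j) \<psi>"
      using orbit_pairs_imp_component_iso[OF ij(1) uv(1) ij(2) uv(2)] by blast
    then show "graph_iso (Gs i) (Gs j)"
      using graph_iso_iff component(1) ij by blast
  qed
qed

end

lemma regular_compact_union_disjoint_union:
  assumes "regular_connected_compact_family k m Gs"
  shows "regular_compact_union k m Gs Pair (disjoint_union m Gs)"
  using assms by unfold_locales (auto simp: disjoint_union_def)

section \<open>The triangle and the square\<close>

definition cycle3 :: "nat pair_pre_digraph" where
  "cycle3 = \<lparr> pverts = {0, 1, 2}, parcs = {(0, 1), (1, 0), (1, 2), (2, 1), (0, 2), (2, 0)} \<rparr>"

definition cycle4 :: "nat pair_pre_digraph" where
  "cycle4 = \<lparr> pverts = {0, 1, 2, 3},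
     parcs = {(0, 1), (1, 0), (1, 2), (2, 1), (2, 3), (3, 2), (3, 0), (0, 3)} \<rparr>"

lemma pair_graph_cycle3: "pair_graph cycle3"
  by (rule pair_graphI) (auto simp: cycle3_def)

lemma pair_graph_cycle4: "pair_graph cycle4"
  by (rule pair_graphI) (auto simp: cycle4_def)

lemma connected_cycle3: "connected_graph cycle3"
proof (rule pair_graph.connected_graphI[OF pair_graph_cycle3])
  show "0 \<in> pverts cycle3" by (simp add: cycle3_def)
  show "(0, v) \<in> (parcs cycle3)\<^sup>*" if "v \<in> pverts cycle3" for v
    using that by (auto simp: cycle3_def)
qed

lemma connected_cycle4: "connected_graph cycle4"
proof (rule pair_graph.connected_graphI[OF pair_graph_cycle4])
  show "0 \<in> pverts cycle4" by (simp add: cycle4_def)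
  have "(0, 1) \<in> parcs cycle4" "(1, 2) \<in> parcs cycle4" "(0, 3) \<in> parcs cycle4"
    by (simp_all add: cycle4_def)
  then show "(0, v) \<in> (parcs cycle4)\<^sup>*" if "v \<in> pverts cycle4" for v
    using that unfolding cycle4_def by (auto intro: rtrancl_into_rtrancl)
qed

lemma regular_graphI:
  assumes "\<And>v. v \<in> pverts G \<Longrightarrow> card {e \<in> parcs G. fst e = v} = k"
  shows "regular_graph k G"
  using assms by (simp add: regular_graph_def out_degree_def out_arcs_def)

lemma regular_cycle3: "regular_graph 2 cycle3"
proof (rule regular_graphI)
  have "{e \<in> parcs cycle3. fst e = 0} = {(0, 1), (0, 2)}"
    "{e \<in> parcs cycle3. fst e = 1} = {(1, 0), (1, 2)}"
    "{e \<in> parcs cycle3. fst e = 2} = {(2, 1), (2, 0)}"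
    by (auto simp: cycle3_def)
  moreover have "v = 0 \<or> v = 1 \<or> v = 2" if "v \<in> pverts cycle3" for v
    using that by (simp add: cycle3_def)
  ultimately show "card {e \<in> parcs cycle3. fst e = v} = 2" if "v \<in> pverts cycle3" for v
    using that by fastforce
qed

lemma regular_cycle4: "regular_graph 2 cycle4"
proof (rule regular_graphI)
  have "{e \<in> parcs cycle4. fst e = 0} = {(0, 1), (0, 3)}"
    "{e \<in> parcs cycle4. fst e = 1} = {(1, 0), (1, 2)}"
    "{e \<in> parcs cycle4. fst e = 2} = {(2, 1), (2, 3)}"
    "{e \<in> parcs cycle4. fst e = 3} = {(3, 2), (3, 0)}"
    by (auto simp: cycle4_def)
  moreover have "v = 0 \<or> v = 1 \<or> v = 2 \<or> v = 3" if "v \<in> pverts cycle4" for v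
    using that by (simp add: cycle4_def)
  ultimately show "card {e \<in> parcs cycle4. fst e = v} = 2" if "v \<in> pverts cycle4" for v
    using that by fastforce
qed

text \<open>The triangle is complete, so each permutation is an automorphism.\<close>

lemma compact_cycle3: "compact_graph cycle3"
proof (rule pair_graph.compact_graphI[OF pair_graph_cycle3])
  fix Q assume Q: "fractional_iso cycle3 cycle3 Q"
  have "finite (pverts cycle3)" by (simp add: cycle3_def)
  then obtain \<sigma> where \<sigma>: "bij_betw \<sigma> (pverts cycle3) (pverts cycle3)" "\<forall>u\<in>pverts cycle3. Q u (\<sigma> u) > 0"
    using doubly_stochastic_permutation[of "pverts cycle3" Q] Q
    unfolding fractional_iso_def by blast
  have arc: "(u, v) \<in> parcs cycle3 \<longleftrightarrow> u \<noteq> v" if "u \<in> pverts cycle3" "v \<in> pverts cycle3" for u v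
  proof -
    have "u = 0 \<or> u = 1 \<or> u = 2" "v = 0 \<or> v = 1 \<or> v = 2"
      using that by (simp_all add: cycle3_def)
    then show ?thesis by (elim disjE) (simp_all add: cycle3_def)
  qed
  have "(u, v) \<in> parcs cycle3 \<longleftrightarrow> (\<sigma> u, \<sigma> v) \<in> parcs cycle3"
    if "u \<in> pverts cycle3" "v \<in> pverts cycle3" for u v
    using that \<sigma>(1) arc[OF that] arc[of "\<sigma> u" "\<sigma> v"]
    by (auto simp: bij_betw_def dest: inj_onD)
  then have "iso_map cycle3 cycle3 \<sigma>" using \<sigma>(1) by (simp add: iso_map_def)
  then show "positive_iso cycle3 cycle3 Q" using \<sigma>(2) by (auto simp: positive_iso_def)
qed

text \<open>
  The eight lists are the automorphisms of the square. The entries of \<open>Q\<close> with even index sum form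
  two \<open>2\<times>2\<close> blocks with constant row and column sums \<open>a\<close>, the other entries two blocks with sums
  \<open>1 - a\<close>; in each case one diagonal of both blocks of a kind is positive.
\<close>

lemma compact_cycle4: "compact_graph cycle4"
proof (rule pair_graph.compact_graphI[OF pair_graph_cycle4])
  fix Q assume Q: "fractional_iso cycle4 cycle4 Q"
  have iso: "iso_map cycle4 cycle4 ((!) xs)"
    if "xs \<in> {[0, 1, 2, 3], [0, 3, 2, 1], [2, 1, 0, 3], [2, 3, 0, 1],
      [1, 0, 3, 2], [1, 2, 3, 0], [3, 0, 1, 2], [3, 2, 1, 0]}" for xs
    using that by (elim insertE emptyE)
      (simp_all add: iso_map_def cycle4_def bij_betw_def insert_commute)
  have pos: "positive_iso cycle4 cycle4 Q"
    if "xs \<in> {[0, 1, 2, 3], [0, 3, 2, 1], [2, 1, 0, 3], [2, 3, 0, 1],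
      [1, 0, 3, 2], [1, 2, 3, 0], [3, 0, 1, 2], [3, 2, 1, 0]}"
      "Q 0 (xs ! 0) > 0" "Q 1 (xs ! 1) > 0" "Q 2 (xs ! 2) > 0" "Q 3 (xs ! 3) > 0" for xs
    using that iso[OF that(1)] by (auto simp: positive_iso_def cycle4_def)
  have V: "pverts cycle4 = {0, 1, 2, 3}" by (simp add: cycle4_def)
  have sum4: "(\<Sum>x\<in>{0, 1, 2, 3}. f x) = f 0 + f 1 + f 2 + f 3" for f :: "nat \<Rightarrow> real"
    by simp
  have comm: "Q i 0 * adj cycle4 0 j + Q i 1 * adj cycle4 1 j + Q i 2 * adj cycle4 2 j + Q i 3 * adj cycle4 3 j =
    adj cycle4 i 0 * Q 0 j + adj cycle4 i 1 * Q 1 j + adj cycle4 i 2 * Q 2 j + adj cycle4 i 3 * Q 3 j"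
    if "i \<in> {0, 1, 2, 3}" "j \<in> {0, 1, 2, 3}" for i j
    using Q that unfolding fractional_iso_def V sum4 by blast
  have adj: "adj cycle4 0 0 = (0::real)" "adj cycle4 0 1 = (1::real)" "adj cycle4 0 2 = (0::real)" "adj cycle4 0 3 = (1::real)"
    "adj cycle4 1 0 = (1::real)" "adj cycle4 1 1 = (0::real)" "adj cycle4 1 2 = (1::real)" "adj cycle4 1 3 = (0::real)"
    "adj cycle4 2 0 = (0::real)" "adj cycle4 2 1 = (1::real)" "adj cycle4 2 2 = (0::real)" "adj cycle4 2 3 = (1::real)"
    "adj cycle4 3 0 = (1::real)" "adj cycle4 3 1 = (0::real)" "adj cycle4 3 2 = (1::real)" "adj cycle4 3 3 = (0::real)"
    by (simp_all add: adj_def cycle4_def)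
  have c: "Q 0 1 + Q 0 3 = Q 1 0 + Q 3 0" "Q 0 0 + Q 0 2 = Q 1 1 + Q 3 1" "Q 0 0 + Q 0 2 = Q 1 3 + Q 3 3"
    "Q 1 1 + Q 1 3 = Q 0 0 + Q 2 0" "Q 1 0 + Q 1 2 = Q 0 1 + Q 2 1" "Q 1 1 + Q 1 3 = Q 0 2 + Q 2 2"
    "Q 1 0 + Q 1 2 = Q 0 3 + Q 2 3" "Q 0 1 + Q 0 3 = Q 1 2 + Q 3 2"
    "Q 2 1 + Q 2 3 = Q 1 0 + Q 3 0" "Q 2 0 + Q 2 2 = Q 1 1 + Q 3 1"
    "Q 3 1 + Q 3 3 = Q 0 0 + Q 2 0" "Q 3 0 + Q 3 2 = Q 0 1 + Q 2 1"
    using comm[of 0 0] comm[of 0 1] comm[of 0 3] comm[of 1 0] comm[of 1 1] comm[of 1 2] comm[of 1 3]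
      comm[of 0 2] comm[of 2 0] comm[of 2 1] comm[of 3 0] comm[of 3 1]
    by (simp_all add: adj del: One_nat_def)
  have row: "Q i 0 + Q i 1 + Q i 2 + Q i 3 = 1" and col: "Q 0 i + Q 1 i + Q 2 i + Q 3 i = 1"
    if "i \<in> {0, 1, 2, 3}" for i
    using Q that unfolding fractional_iso_def V sum4 by blast+
  have s: "Q 0 0 + Q 0 1 + Q 0 2 + Q 0 3 = 1" "Q 1 0 + Q 1 1 + Q 1 2 + Q 1 3 = 1"
    "Q 2 0 + Q 2 1 + Q 2 2 + Q 2 3 = 1" "Q 3 0 + Q 3 1 + Q 3 2 + Q 3 3 = 1"
    "Q 0 0 + Q 1 0 + Q 2 0 + Q 3 0 = 1" "Q 0 1 + Q 1 1 + Q 2 1 + Q 3 1 = 1"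
    using row[of 0] row[of 1] row[of 2] row[of 3] col[of 0] col[of 1] by simp_all
  \<comment> \<open>Shifting both indices by 2 modulo 4 preserves \<open>Q\<close>, so rows 0 and 1
    determine the matrix.\<close>
  have sym: "Q 2 2 = Q 0 0" "Q 2 0 = Q 0 2" "Q 3 3 = Q 1 1" "Q 3 1 = Q 1 3"
    "Q 2 3 = Q 0 1" "Q 2 1 = Q 0 3" "Q 3 2 = Q 1 0" "Q 3 0 = Q 1 2"
    "Q 1 1 + Q 1 3 = Q 0 0 + Q 0 2" "Q 1 0 + Q 1 2 = Q 0 1 + Q 0 3"
    using c s by linarith+
  have "Q 0 0 + Q 0 2 > 0 \<or> Q 0 1 + Q 0 3 > 0"
    using s(1) by linarith
  moreover have "(Q 0 0 > 0 \<or> Q 0 2 > 0) \<and> (Q 1 1 > 0 \<or> Q 1 3 > 0)" if "Q 0 0 + Q 0 2 > 0"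
  proof
    show "Q 0 0 > 0 \<or> Q 0 2 > 0" using that by linarith
    have "Q 1 1 + Q 1 3 > 0" using that sym by linarith
    then show "Q 1 1 > 0 \<or> Q 1 3 > 0" by linarith
  qed
  moreover have "(Q 0 1 > 0 \<or> Q 0 3 > 0) \<and> (Q 1 0 > 0 \<or> Q 1 2 > 0)" if "Q 0 1 + Q 0 3 > 0"
  proof
    show "Q 0 1 > 0 \<or> Q 0 3 > 0" using that by linarith
    have "Q 1 0 + Q 1 2 > 0" using that sym by linarith
    then show "Q 1 0 > 0 \<or> Q 1 2 > 0" by linarith
  qed
  \<comment> \<open>A case picks one positive entry in each of rows 0 and 1, both with even or both
    with odd index sum; \<open>sym\<close> extends the choice to an automorphism of the
    square.\<close>
  ultimately consider "Q 0 0 > 0" "Q 1 1 > 0" | "Q 0 0 > 0" "Q 1 3 > 0" | "Q 0 2 > 0" "Q 1 1 > 0"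
    | "Q 0 2 > 0" "Q 1 3 > 0" | "Q 0 1 > 0" "Q 1 0 > 0" | "Q 0 1 > 0" "Q 1 2 > 0"
    | "Q 0 3 > 0" "Q 1 0 > 0" | "Q 0 3 > 0" "Q 1 2 > 0"
    by blast
  then show "positive_iso cycle4 cycle4 Q"
  proof cases
    case 1 then show ?thesis using pos[of "[0, 1, 2, 3]"] sym(1,3) by simp
  next
    case 2 then show ?thesis using pos[of "[0, 3, 2, 1]"] sym(1,4) by simp
  next
    case 3 then show ?thesis using pos[of "[2, 1, 0, 3]"] sym(2,3) by simp
  next
    case 4 then show ?thesis using pos[of "[2, 3, 0, 1]"] sym(2,4) by simp
  next
    case 5 then show ?thesis using pos[of "[1, 0, 3, 2]"] sym(5,7) by simp
  next
    case 6 then show ?thesis using pos[of "[1, 2, 3, 0]"] sym(5,8) by simp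
  next
    case 7 then show ?thesis using pos[of "[3, 0, 1, 2]"] sym(6,7) by simp
  next
    case 8 then show ?thesis using pos[of "[3, 2, 1, 0]"] sym(6,8) by simp
  qed
qed

section \<open>An exact graph that is not compact\<close>

definition two_cycles :: "nat \<Rightarrow> nat pair_pre_digraph" where
  "two_cycles i = (if i = 1 then cycle3 else cycle4)"

lemma family_two_cycles: "regular_connected_compact_family 2 2 two_cycles"
  by (simp add: regular_connected_compact_family_def two_cycles_def pair_graph_cycle3 pair_graph_cycle4
      regular_cycle3 regular_cycle4 connected_cycle3 connected_cycle4 compact_cycle3 compact_cycle4)

lemma two_cycles_not_iso: "\<not> graph_iso (two_cycles 1) (two_cycles 2)"
proof
  assume "graph_iso (two_cycles 1) (two_cycles 2)"
  then obtain \<pi> where "iso_map cycle3 cycle4 \<pi>"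
    using graph_iso_iff[OF pair_graph_cycle3 pair_graph_cycle4] by (auto simp: two_cycles_def)
  then have "card (pverts cycle3) = card (pverts cycle4)"
    by (auto simp: iso_map_def dest: bij_betw_same_card)
  then show False by (simp add: cycle3_def cycle4_def)
qed

text \<open>The embedding is left open because the result is used both for the tagged union and for
  a copy on the natural numbers.\<close>

lemma not_compact_two_cycles:
  assumes "regular_compact_union 2 2 two_cycles e G"
  shows "\<not> compact_graph G"
proof -
  interpret regular_compact_union 2 2 two_cycles e G by fact
  have "(1::nat) \<in> {1..2}" "(2::nat) \<in> {1..2}" by auto
  then show ?thesis using compact_union_iff two_cycles_not_iso by blast
qed

lemma exact_not_compact_exists:
  "\<exists>H :: nat pair_pre_digraph. pair_graph H \<and> exact_graph H \<and> \<not> compact_graph H"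
proof -
  \<comment> \<open>The vertices of both cycles are below 4, so this places the components
    disjointly inside the natural numbers.\<close>
  define e where "e i u = 4 * i + u" for i u :: nat
  define H where "H = \<lparr> pverts = (\<lambda>(i, u). e i u) ` (SIGMA i:{1..2}. pverts (two_cycles i)),
    parcs = {(e i u, e i v) | i u v. i \<in> {1..2} \<and> (u, v) \<in> parcs (two_cycles i)} \<rparr>"
  have lt: "u < 4" if "u \<in> pverts (two_cycles i)" for i u
    using that by (auto simp: two_cycles_def cycle3_def cycle4_def split: if_splits)
  have e_inj: "i = j \<and> u = v" if "e i u = e j v" "u < 4" "v < 4" for i j u v
    using that unfolding e_def by presburger
  have "inj_on (\<lambda>(i, u). e i u) (SIGMA i:{1..2}. pverts (two_cycles i))"
  proof (rule inj_onI)
    fix p q assume "p \<in> (SIGMA i:{1..2}. pverts (two_cycles i))"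
      "q \<in> (SIGMA i:{1..2}. pverts (two_cycles i))"
      and eq: "(case p of (i, u) \<Rightarrow> e i u) = (case q of (i, u) \<Rightarrow> e i u)"
    then obtain i u j v where "p = (i, u)" "u \<in> pverts (two_cycles i)"
      "q = (j, v)" "v \<in> pverts (two_cycles j)" by blast
    then show "p = q" using e_inj[of i u j v] lt[of u i] lt[of v j] eq by simp
  qed
  then have union: "regular_compact_union 2 2 two_cycles e H"
    using family_two_cycles by unfold_locales (auto simp: H_def)
  show ?thesis
    using regular_compact_union.pair_graph_union[OF union] regular_compact_union.exact_union[OF union]
      not_compact_two_cycles[OF union] by blast
qed

text \<open>Strictness and the counterexample require a vertex type with enough elements, hence
  natural numbers; the implications are stated for an arbitrary vertex type.\<close>

theorem theorem4p4:
  shows "{H :: nat pair_pre_digraph. pair_graph H \<and> compact_graph H}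
           \<subset> {H. pair_graph H \<and> exact_graph H}
    \<and> (\<forall>G :: 'a pair_pre_digraph. pair_graph G \<longrightarrow> compact_graph G \<longrightarrow> exact_graph G)
    \<and> (\<forall>(k :: nat) (m :: nat) (Gs :: nat \<Rightarrow> 'a pair_pre_digraph).
         regular_connected_compact_family k m Gs \<longrightarrow>
           exact_graph (disjoint_union m Gs)
           \<and> (compact_graph (disjoint_union m Gs)
                \<longleftrightarrow> (\<forall>i\<in>{1..m}. \<forall>j\<in>{1..m}. graph_iso (Gs i) (Gs j))))
    \<and> (\<exists>(k :: nat) (m :: nat) (Gs :: nat \<Rightarrow> nat pair_pre_digraph).
         regular_connected_compact_family k m Gs
           \<and> \<not> compact_graph (disjoint_union m Gs))"
proof (intro conjI allI impI)
  show "{H :: nat pair_pre_digraph. pair_graph H \<and> compact_graph H} \<subset> {H. pair_graph H \<and> exact_graph H}"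
    using pair_graph.compact_imp_exact exact_not_compact_exists by blast
  show "exact_graph G" if "pair_graph G" "compact_graph G" for G :: "'a pair_pre_digraph"
    using that by (rule pair_graph.compact_imp_exact)
  show "exact_graph (disjoint_union m Gs)" if "regular_connected_compact_family k m Gs"
    for k m and Gs :: "nat \<Rightarrow> 'a pair_pre_digraph"
    using regular_compact_union.exact_union[OF regular_compact_union_disjoint_union[OF that]] .
  show "compact_graph (disjoint_union m Gs) \<longleftrightarrow> (\<forall>i\<in>{1..m}. \<forall>j\<in>{1..m}. graph_iso (Gs i) (Gs j))"
    if "regular_connected_compact_family k m Gs" for k m and Gs :: "nat \<Rightarrow> 'a pair_pre_digraph"
    using regular_compact_union.compact_union_iff[OF regular_compact_union_disjoint_union[OF that]] .
  show "\<exists>(k :: nat) (m :: nat) (Gs :: nat \<Rightarrow> nat pair_pre_digraph).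
      regular_connected_compact_family k m Gs \<and> \<not> compact_graph (disjoint_union m Gs)"
    using family_two_cycles not_compact_two_cycles[OF regular_compact_union_disjoint_union] by blast
qed

end
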